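(* Let $\mathbf k$ be a field of characteristic $0$, $\lambda\in\mathbf k$, and let $(\mathfrak g,\mu,d)$ be a differential Lie algebra of weight $\lambda$ over $\mathbf k$. Let $\mathfrak h=\mathfrak g'$ be a second copy of the vector space $\mathfrak g$. Let $(L,M,\iota_M,A,\iota_A,P,\Delta=0)$ be the absolute generalised V-datum of $\mathfrak g$ and $(L',M',\iota_{M'},A',\iota_{A'},P',\Delta'=0)$ the relative generalised V-datum of $(\mathfrak g,\mathfrak h)$, both described in the context. Let $f_L:L\to L'$ and $f_A:A\to A'$ be the identity maps (identifying $\mathfrak g'$ with $\mathfrak h$), and let $f_M:M\to M'$ be given by the same formula as $\iota_M$. Then $f=(f_L,f_M,f_A)$ is a morphism of generalised V-data from $(L,M,\iota_M,A,\iota_A,P,0)$ to $(L',M',\iota_{M'},A',\iota_{A'},P',0)$, and it induces an injective homomorphism of $L_\infty[1]$-algebras $sM\oplus A\to sM'\oplus A'$, $(sh,\xi)\mapsto(sf_M(h),f_A(\xi))$, where both sides carry the $L_\infty[1]$-structures (with parameter $\lambda$) described in the context.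
   Context: A differential Lie algebra of weight $\lambda$ is a Lie algebra with a linear operator $d$ satisfying $d([x,y])=[d(x),y]+[x,d(y)]+\lambda[d(x),d(y)]$. $\bar\wedge V=\bigoplus_{k\ge1}\wedge^kV$; $\mathrm{Hom}(\wedge^{n+1}V,V)$ has degree $n$ in $\mathrm{Hom}(\bar\wedge V,V)$, a graded Lie algebra under $[f,g]_{\mathrm{NR}}=f\bar\circ g-(-1)^{pq}g\bar\circ f$ ($f,g$ of degrees $p,q$), $f\bar\circ g(x_1,\dots,x_{p+q+1})=\sum_{\sigma\in\mathrm{Sh}(q+1,p)}\mathrm{sgn}(\sigma)f(g(x_{\sigma(1)},\dots,x_{\sigma(q+1)}),x_{\sigma(q+2)},\dots)$. Via $\wedge^n(V\oplus W)\cong\bigoplus_{k+l=n}\wedge^kV\otimes\wedge^lW$ (using signed $(k,l)$-shuffles), $\mathrm{Hom}(\wedge^kV\otimes\wedge^lW,X)$, $X\in\{V,W\}$, is a direct summand of $\mathrm{Hom}(\bar\wedge(V\oplus W),V\oplus W)$. Generalised V-datum $(L,M,\iota_M,A,\iota_A,P,\Delta)$: graded Lie algebra $L$; graded Lie algebra $M$ with injective graded Lie homomorphism $\iota_M:M\to L$; abelian graded Lie algebra $A$ with injective graded Lie homomorphism $\iota_A:A\to L$; degree $0$ linear $P:L\to A$ with $P\iota_A=\mathrm{Id}_A$ and $\mathrm{Ker}(P)$ a graded Lie subalgebra; $\Delta\in\mathrm{Ker}(P)^1$ with $[\Delta,\Delta]=0$, $[\Delta,\iota_M(M)]\subset\iota_M(M)$.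 A morphism to $(L',M',\iota_{M'},A',\iota_{A'},P',\Delta')$ is a triple of graded Lie algebra homomorphisms $f_L:L\to L'$, $f_M:M\to M'$, $f_A:A\to A'$ with $f_L\iota_M=\iota_{M'}f_M$, $f_L\iota_A=\iota_{A'}f_A$, $f_AP=P'f_L$, $f_L(\Delta)=\Delta'$. Absolute datum: $L=\mathrm{Hom}(\bar\wedge(\mathfrak g\oplus\mathfrak g'),\mathfrak g\oplus\mathfrak g')$; $M=\mathrm{Hom}(\bar\wedge\mathfrak g,\mathfrak g)$ with $[\,,]_{\mathrm{NR}}$; $A=\mathrm{Hom}(\bar\wedge\mathfrak g,\mathfrak g)$ with zero bracket; for $f\in\mathrm{Hom}(\wedge^{n+1}\mathfrak g,\mathfrak g)$, $\iota_M(f)=\sum_{i=0}^{n+1}f_i$ where $f_0=f:\wedge^{n+1}\mathfrak g\to\mathfrak g$ and for $i\ge1$, $f_i:\wedge^{n+1-i}\mathfrak g\otimes\wedge^i\mathfrak g'\to\mathfrak g'$ is $f_i(x_1\wedge\dots\wedge x_{n+1-i}\otimes y_{n+2-i}\wedge\dots\wedge y_{n+1})=f(x_1\wedge\dots\wedge x_{n+1-i}\wedge y_{n+2-i}\wedge\dots\wedge y_{n+1})$; $\iota_A$ identifies $A$ with $\mathrm{Hom}(\bar\wedge\mathfrak g,\mathfrak g')\subset L$ and $P$ is the projection onto it. Relative datum: $L'=\mathrm{Hom}(\bar\wedge(\mathfrak g\oplus\mathfrak h),\mathfrak g\oplus\mathfrak h)$; $M'=\mathrm{Hom}(\bar\wedge\mathfrak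 g,\mathfrak g)\oplus\mathrm{Hom}(\bar\wedge\mathfrak g\otimes\bar\wedge\mathfrak h,\mathfrak h)\oplus\mathrm{Hom}(\bar\wedge\mathfrak h,\mathfrak h)$ with bracket induced from $L'$; $A'=\mathrm{Hom}(\bar\wedge\mathfrak g,\mathfrak h)$; $\iota_{M'},\iota_{A'}$ natural injections, $P'$ natural projection. In both cases, with $(sV)^n=V^{n+1}$, the $L_\infty[1]$-structure (graded symmetric degree $1$ operations satisfying the generalised Jacobi identities) on $sM\oplus A$ (resp. $sM'\oplus A'$) is $l_2(sf,sg)=(-1)^{|f|}s[f,g]$, $l_i(sf,\xi_1,\dots,\xi_{i-1})=\lambda^{i-2}P[\cdots[\iota_M(f),\iota_A(\xi_1)],\cdots,\iota_A(\xi_{i-1})]$ for $i\ge2$ (resp. with primes), extended by graded symmetry, other components zero. Homomorphism here means a degree $0$ linear map commuting with all $l_n$. *)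

theory Defs
  imports
    "HOL-Analysis.Product_Vector"
    "HOL-Library.Function_Algebras"
    "HOL-Combinatorics.Permutations"
begin

section \<open>Differential Lie algebras\<close>

definition Lie_algebra ::
  "('k::field \<Rightarrow> 'g::ab_group_add \<Rightarrow> 'g) \<Rightarrow> ('g \<Rightarrow> 'g \<Rightarrow> 'g) \<Rightarrow> bool" where
  "Lie_algebra s mu \<longleftrightarrow>
     vector_space s \<and>
     (\<forall>x. Vector_Spaces.linear s s (mu x)) \<and>
     (\<forall>y. Vector_Spaces.linear s s (\<lambda>x. mu x y)) \<and>
     (\<forall>x. mu x x = 0) \<and>
     (\<forall>x y z. mu x (mu y z) + mu y (mu z x) + mu z (mu x y) = 0)"

definition differential_Lie_algebra ::
  "('k::field \<Rightarrow> 'g::ab_group_add \<Rightarrow> 'g) \<Rightarrow> 'k \<Rightarrow> ('g \<Rightarrow> 'g \<Rightarrow> 'g) \<Rightarrow> ('g \<Rightarrow> 'g) \<Rightarrow> bool" where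
  "differential_Lie_algebra s lam mu d \<longleftrightarrow>
     Lie_algebra s mu \<and>
     Vector_Spaces.linear s s d \<and>
     (\<forall>x y. d (mu x y) = mu (d x) y + mu x (d y) + s lam (mu (d x) (d y)))"


section \<open>Graded vector spaces and graded Lie algebras\<close>

text \<open>A \<open>\<int>\<close>-graded vector space is an internal direct sum of subspaces of an ambient vector
  space; only its total space, the span of the homogeneous components, is meaningful.\<close>

record ('k, 'a) graded_space =
  gscale :: "'k \<Rightarrow> 'a \<Rightarrow> 'a"
  gcomp :: "int \<Rightarrow> 'a set"

definition graded_vector_space ::
  "('k::field, 'a::ab_group_add, 'more) graded_space_scheme \<Rightarrow> bool" where
  "graded_vector_space V \<longleftrightarrow>
     vector_space (gscale V) \<and>
     (\<forall>n. module.subspace (gscale V) (gcomp V n)) \<and>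
     (\<forall>N x. finite N \<longrightarrow> (\<forall>n\<in>N. x n \<in> gcomp V n) \<longrightarrow> (\<Sum>n\<in>N. x n) = 0 \<longrightarrow> (\<forall>n\<in>N. x n = 0))"

definition gtotal :: "('k::field, 'a::ab_group_add, 'more) graded_space_scheme \<Rightarrow> 'a set" where
  "gtotal V = module.span (gscale V) (\<Union>n. gcomp V n)"

definition graded_linear_map ::
  "('k::field, 'a::ab_group_add, 'm1) graded_space_scheme \<Rightarrow>
   ('k, 'b::ab_group_add, 'm2) graded_space_scheme \<Rightarrow> ('a \<Rightarrow> 'b) \<Rightarrow> bool" where
  "graded_linear_map V W f \<longleftrightarrow>
     (\<forall>x\<in>gtotal V. \<forall>y\<in>gtotal V. f (x + y) = f x + f y) \<and>
     (\<forall>c. \<forall>x\<in>gtotal V. f (gscale V c x) = gscale W c (f x)) \<and>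
     (\<forall>n. \<forall>x\<in>gcomp V n. f x \<in> gcomp W n)"

record ('k, 'a) graded_Lie = "('k, 'a) graded_space" +
  gbr :: "'a \<Rightarrow> 'a \<Rightarrow> 'a"

definition graded_Lie_algebra ::
  "('k::field, 'a::ab_group_add, 'more) graded_Lie_scheme \<Rightarrow> bool" where
  "graded_Lie_algebra L \<longleftrightarrow>
     graded_vector_space L \<and>
     (\<forall>x\<in>gtotal L. \<forall>y\<in>gtotal L. \<forall>z\<in>gtotal L.
        gbr L (x + y) z = gbr L x z + gbr L y z \<and> gbr L z (x + y) = gbr L z x + gbr L z y) \<and>
     (\<forall>c. \<forall>x\<in>gtotal L. \<forall>y\<in>gtotal L.
        gbr L (gscale L c x) y = gscale L c (gbr L x y) \<and>
        gbr L x (gscale L c y) = gscale L c (gbr L x y)) \<and>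
     (\<forall>p q. \<forall>x\<in>gcomp L p. \<forall>y\<in>gcomp L q. gbr L x y \<in> gcomp L (p + q)) \<and>
     (\<forall>p q. \<forall>x\<in>gcomp L p. \<forall>y\<in>gcomp L q.
        gbr L x y = - gscale L ((- 1) powi (p * q)) (gbr L y x)) \<and>
     (\<forall>p q r. \<forall>x\<in>gcomp L p. \<forall>y\<in>gcomp L q. \<forall>z\<in>gcomp L r.
        gbr L x (gbr L y z) =
          gbr L (gbr L x y) z + gscale L ((- 1) powi (p * q)) (gbr L y (gbr L x z)))"

definition abelian_graded_Lie_algebra ::
  "('k::field, 'a::ab_group_add, 'more) graded_Lie_scheme \<Rightarrow> bool" where
  "abelian_graded_Lie_algebra L \<longleftrightarrow>
     graded_Lie_algebra L \<and> (\<forall>x\<in>gtotal L. \<forall>y\<in>gtotal L. gbr L x y = 0)"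

definition graded_Lie_hom ::
  "('k::field, 'a::ab_group_add, 'm1) graded_Lie_scheme \<Rightarrow>
   ('k, 'b::ab_group_add, 'm2) graded_Lie_scheme \<Rightarrow> ('a \<Rightarrow> 'b) \<Rightarrow> bool" where
  "graded_Lie_hom L L' f \<longleftrightarrow>
     graded_linear_map L L' f \<and>
     (\<forall>x\<in>gtotal L. \<forall>y\<in>gtotal L. f (gbr L x y) = gbr L' (f x) (f y))"

definition graded_Lie_subalgebra ::
  "('k::field, 'a::ab_group_add, 'more) graded_Lie_scheme \<Rightarrow> (int \<Rightarrow> 'a set) \<Rightarrow> bool" where
  "graded_Lie_subalgebra L K \<longleftrightarrow>
     (\<forall>n. module.subspace (gscale L) (K n) \<and> K n \<subseteq> gcomp L n) \<and>
     (\<forall>p q. \<forall>x\<in>K p. \<forall>y\<in>K q. gbr L x y \<in> K (p + q))"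

definition gker ::
  "('k, 'a, 'more) graded_space_scheme \<Rightarrow> ('a \<Rightarrow> 'b::zero) \<Rightarrow> int \<Rightarrow> 'a set" where
  "gker V f n = {x \<in> gcomp V n. f x = 0}"


section \<open>Generalised V-data\<close>

record ('k, 'l, 'm, 'a) V_datum =
  dL :: "('k, 'l) graded_Lie"
  dM :: "('k, 'm) graded_Lie"
  iM :: "'m \<Rightarrow> 'l"
  dA :: "('k, 'a) graded_Lie"
  iA :: "'a \<Rightarrow> 'l"
  dP :: "'l \<Rightarrow> 'a"
  dDelta :: 'l

definition generalised_V_datum ::
  "('k::field, 'l::ab_group_add, 'm::ab_group_add, 'a::ab_group_add) V_datum \<Rightarrow> bool" where
  "generalised_V_datum D \<longleftrightarrow>
     graded_Lie_algebra (dL D) \<and>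
     graded_Lie_algebra (dM D) \<and>
     graded_Lie_hom (dM D) (dL D) (iM D) \<and> inj_on (iM D) (gtotal (dM D)) \<and>
     abelian_graded_Lie_algebra (dA D) \<and>
     graded_Lie_hom (dA D) (dL D) (iA D) \<and> inj_on (iA D) (gtotal (dA D)) \<and>
     graded_linear_map (dL D) (dA D) (dP D) \<and>
     (\<forall>a\<in>gtotal (dA D). dP D (iA D a) = a) \<and>
     graded_Lie_subalgebra (dL D) (gker (dL D) (dP D)) \<and>
     dDelta D \<in> gker (dL D) (dP D) 1 \<and>
     gbr (dL D) (dDelta D) (dDelta D) = 0 \<and>
     (\<forall>m\<in>gtotal (dM D). gbr (dL D) (dDelta D) (iM D m) \<in> iM D ` gtotal (dM D))"

definition V_datum_morphism ::
  "('k::field, 'l::ab_group_add, 'm::ab_group_add, 'a::ab_group_add) V_datum \<Rightarrow>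
   ('k, 'l2::ab_group_add, 'm2::ab_group_add, 'a2::ab_group_add) V_datum \<Rightarrow>
   ('l \<Rightarrow> 'l2) \<Rightarrow> ('m \<Rightarrow> 'm2) \<Rightarrow> ('a \<Rightarrow> 'a2) \<Rightarrow> bool" where
  "V_datum_morphism D D' fL fM fA \<longleftrightarrow>
     generalised_V_datum D \<and> generalised_V_datum D' \<and>
     graded_Lie_hom (dL D) (dL D') fL \<and>
     graded_Lie_hom (dM D) (dM D') fM \<and>
     graded_Lie_hom (dA D) (dA D') fA \<and>
     (\<forall>m\<in>gtotal (dM D). fL (iM D m) = iM D' (fM m)) \<and>
     (\<forall>a\<in>gtotal (dA D). fL (iA D a) = iA D' (fA a)) \<and>
     (\<forall>x\<in>gtotal (dL D). fA (dP D x) = dP D' (fL x)) \<and>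
     fL (dDelta D) = dDelta D'"


section \<open>The operations on \<open>sM \<oplus> A\<close>\<close>

text \<open>\<open>gop V [d\<^sub>1, \<dots>, d\<^sub>n]\<close> is the component on \<open>V\<^bsup>d\<^sub>1\<^esup> \<times> \<dots> \<times> V\<^bsup>d\<^sub>n\<^esup>\<close> of the multilinear
  operation \<open>l\<^sub>n\<close>; it is only meaningful on elements of these degrees. Homomorphisms only involve
  the operations, so the generalised Jacobi identities are not part of the record.\<close>

record ('k, 'v) Linf_structure = "('k, 'v) graded_space" +
  gop :: "int list \<Rightarrow> 'v list \<Rightarrow> 'v"

definition Linf_hom ::
  "('k::field, 'v::ab_group_add) Linf_structure \<Rightarrow> ('k, 'w::ab_group_add) Linf_structure \<Rightarrow>
   ('v \<Rightarrow> 'w) \<Rightarrow> bool" where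
  "Linf_hom V W f \<longleftrightarrow>
     graded_linear_map V W f \<and>
     (\<forall>ds vs. vs \<noteq> [] \<longrightarrow> list_all2 (\<lambda>d v. v \<in> gcomp V d) ds vs \<longrightarrow>
        f (gop V ds vs) = gop W ds (map f vs))"

text \<open>An element of degree \<open>d\<close> of \<open>sM \<oplus> A\<close> is a pair \<open>(f, \<xi>)\<close> with \<open>f \<in> M\<^bsup>d+1\<^esup>\<close> and
  \<open>\<xi> \<in> A\<^bsup>d\<^esup>\<close>. By multilinearity \<open>l\<^sub>n\<close> is the sum of its values on the tuples that pick one of
  the two entries at each position: only those with all entries in \<open>A\<close> but one contribute (the
  \<open>j\<close>-th summand below, where \<open>sf\<^sub>j\<close> is moved to the front with the sign prescribed by graded
  symmetry), and for \<open>n = 2\<close> also the one with both entries in \<open>sM\<close>. There \<open>|f| = d + 1\<close>.\<close>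

definition Linf_ops ::
  "'k::field \<Rightarrow> ('k, 'l::ab_group_add, 'm::ab_group_add, 'a::ab_group_add) V_datum \<Rightarrow>
   int list \<Rightarrow> ('m \<times> 'a) list \<Rightarrow> 'm \<times> 'a" where
  "Linf_ops lam D ds vs =
     (if length vs = 2
      then gscale (dM D) ((- 1) powi (ds ! 0 + 1)) (gbr (dM D) (fst (vs ! 0)) (fst (vs ! 1)))
      else 0,
      if length vs \<ge> 2
      then \<Sum>j<length vs.
        gscale (dA D) ((- 1) powi (ds ! j * sum_list (take j ds)) * lam ^ (length vs - 2))
          (dP D (foldl (gbr (dL D)) (iM D (fst (vs ! j)))
            (map (\<lambda>v. iA D (snd v)) (take j vs @ drop (Suc j) vs))))
      else 0)"

definition Linf_algebra_of ::
  "'k::field \<Rightarrow> ('k, 'l::ab_group_add, 'm::ab_group_add, 'a::ab_group_add) V_datum \<Rightarrow>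
   ('k, 'm \<times> 'a) Linf_structure" where
  "Linf_algebra_of lam D =
     \<lparr> gscale = module_prod.scale (gscale (dM D)) (gscale (dA D)),
       gcomp = (\<lambda>d. gcomp (dM D) (d + 1) \<times> gcomp (dA D) d),
       gop = Linf_ops lam D \<rparr>"


section \<open>Exterior powers and the Nijenhuis-Richardson bracket\<close>

text \<open>\<open>Hom(\<wedge>\<^sup>kV, X)\<close> is the space of alternating \<open>k\<close>-linear maps from \<open>V\<close> to \<open>X\<close>, encoded as
  functions on lists that vanish on all lists of length other than \<open>k\<close>.\<close>

definition wedge_hom ::
  "('k::field \<Rightarrow> 'v::ab_group_add \<Rightarrow> 'v) \<Rightarrow> ('k \<Rightarrow> 'x::ab_group_add \<Rightarrow> 'x) \<Rightarrow> nat \<Rightarrow>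
   ('v list \<Rightarrow> 'x) set" where
  "wedge_hom sV sX k =
     {f. (\<forall>xs. length xs \<noteq> k \<longrightarrow> f xs = 0) \<and>
         (\<forall>xs i. length xs = k \<longrightarrow> i < k \<longrightarrow> Vector_Spaces.linear sV sX (\<lambda>x. f (xs[i := x]))) \<and>
         (\<forall>xs i j. length xs = k \<longrightarrow> i < j \<longrightarrow> j < k \<longrightarrow> xs ! i = xs ! j \<longrightarrow> f xs = 0)}"

text \<open>\<open>Hom(\<wedge>\<^sup>kV \<otimes> \<wedge>\<^sup>lW, X)\<close>.\<close>

definition wedge_tensor_hom ::
  "('k::field \<Rightarrow> 'v::ab_group_add \<Rightarrow> 'v) \<Rightarrow> ('k \<Rightarrow> 'w::ab_group_add \<Rightarrow> 'w) \<Rightarrow>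
   ('k \<Rightarrow> 'x::ab_group_add \<Rightarrow> 'x) \<Rightarrow> nat \<Rightarrow> nat \<Rightarrow> ('v list \<Rightarrow> 'w list \<Rightarrow> 'x) set" where
  "wedge_tensor_hom sV sW sX k l =
     {F. (\<forall>ys. (\<lambda>xs. F xs ys) \<in> wedge_hom sV sX k) \<and> (\<forall>xs. F xs \<in> wedge_hom sW sX l)}"

text \<open>The graded space \<open>Hom(\<wedge>V, X)\<close> over all exterior powers of order at least one;
  \<open>Hom(\<wedge>\<^bsup>n+1\<^esup>V, X)\<close> has degree \<open>n\<close>.\<close>

definition Hom_scale :: "('k \<Rightarrow> 'x \<Rightarrow> 'x) \<Rightarrow> 'k \<Rightarrow> ('v list \<Rightarrow> 'x) \<Rightarrow> 'v list \<Rightarrow> 'x" where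
  "Hom_scale sX c f = (\<lambda>xs. sX c (f xs))"

definition Hom_comp ::
  "('k::field \<Rightarrow> 'v::ab_group_add \<Rightarrow> 'v) \<Rightarrow> ('k \<Rightarrow> 'x::ab_group_add \<Rightarrow> 'x) \<Rightarrow> int \<Rightarrow>
   ('v list \<Rightarrow> 'x) set" where
  "Hom_comp sV sX n = (if n \<ge> 0 then wedge_hom sV sX (nat n + 1) else {0})"

text \<open>\<open>(i, j)\<close>-shuffles; positions are numbered from \<open>0\<close>.\<close>

definition Sh :: "nat \<Rightarrow> nat \<Rightarrow> (nat \<Rightarrow> nat) set" where
  "Sh i j = {\<sigma>. \<sigma> permutes {..<i + j} \<and> strict_mono_on {..<i} \<sigma> \<and> strict_mono_on {i..<i + j} \<sigma>}"

text \<open>\<open>NR_circ s p q f g\<close> composes the component of \<open>f\<close> of degree \<open>p\<close> with that of \<open>g\<close> of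
  degree \<open>q\<close>: they are evaluated on lists of length \<open>p + 1\<close> and \<open>q + 1\<close> only.\<close>

definition NR_circ ::
  "('k::field \<Rightarrow> 'v::ab_group_add \<Rightarrow> 'v) \<Rightarrow> nat \<Rightarrow> nat \<Rightarrow> ('v list \<Rightarrow> 'v) \<Rightarrow> ('v list \<Rightarrow> 'v) \<Rightarrow>
   'v list \<Rightarrow> 'v" where
  "NR_circ s p q f g xs =
     (if length xs = p + q + 1
      then \<Sum>\<sigma>\<in>Sh (q + 1) p. s (of_int (sign \<sigma>))
        (f (g (map (\<lambda>i. xs ! \<sigma> i) [0..<q + 1]) # map (\<lambda>i. xs ! \<sigma> i) [q + 1..<p + q + 1]))
      else 0)"

definition NR_bracket ::
  "('k::field \<Rightarrow> 'v::ab_group_add \<Rightarrow> 'v) \<Rightarrow> ('v list \<Rightarrow> 'v) \<Rightarrow> ('v list \<Rightarrow> 'v) \<Rightarrow> 'v list \<Rightarrow> 'v" where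
  "NR_bracket s f g xs =
     (\<Sum>(p, q) | p + q + 1 = length xs.
        NR_circ s p q f g xs - s ((- 1) ^ (p * q)) (NR_circ s q p g f xs))"

definition NR_algebra ::
  "('k::field \<Rightarrow> 'v::ab_group_add \<Rightarrow> 'v) \<Rightarrow> ('k, 'v list \<Rightarrow> 'v) graded_Lie" where
  "NR_algebra s =
     \<lparr> gscale = Hom_scale s, gcomp = Hom_comp s s, gbr = NR_bracket s \<rparr>"

definition abelian_Hom ::
  "('k::field \<Rightarrow> 'v::ab_group_add \<Rightarrow> 'v) \<Rightarrow> ('k \<Rightarrow> 'x::ab_group_add \<Rightarrow> 'x) \<Rightarrow>
   ('k, 'v list \<Rightarrow> 'x) graded_Lie" where
  "abelian_Hom sV sX =
     \<lparr> gscale = Hom_scale sX, gcomp = Hom_comp sV sX, gbr = (\<lambda>_ _. 0) \<rparr>"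


section \<open>Direct summands of \<open>Hom(\<wedge>(V \<oplus> W), V \<oplus> W)\<close>\<close>

text \<open>The map \<open>\<wedge>\<^bsup>k+l\<^esup>(V \<oplus> W) \<rightarrow> X\<close> given by \<open>F\<close> on the summand \<open>\<wedge>\<^sup>kV \<otimes> \<wedge>\<^sup>lW\<close> and by zero on
  the other summands: \<open>(x\<^sub>1, y\<^sub>1) \<wedge> \<dots> \<wedge> (x\<^sub>n, y\<^sub>n)\<close> has the component
  \<open>\<Sum> sgn(\<sigma>) x\<^bsub>\<sigma>(1)\<^esub> \<wedge> \<dots> \<wedge> x\<^bsub>\<sigma>(k)\<^esub> \<otimes> y\<^bsub>\<sigma>(k+1)\<^esub> \<wedge> \<dots> \<wedge> y\<^bsub>\<sigma>(n)\<^esub>\<close> over the \<open>(k, l)\<close>-shuffles.\<close>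

definition summand_ext ::
  "('k::field \<Rightarrow> 'x::ab_group_add \<Rightarrow> 'x) \<Rightarrow> nat \<Rightarrow> nat \<Rightarrow> ('v list \<Rightarrow> 'w list \<Rightarrow> 'x) \<Rightarrow>
   ('v \<times> 'w) list \<Rightarrow> 'x" where
  "summand_ext sX k l F zs =
     (if length zs = k + l
      then \<Sum>\<sigma>\<in>Sh k l. sX (of_int (sign \<sigma>))
        (F (map (\<lambda>i. fst (zs ! \<sigma> i)) [0..<k]) (map (\<lambda>i. snd (zs ! \<sigma> i)) [k..<k + l]))
      else 0)"

definition emb_left ::
  "('k::field \<Rightarrow> 'v::ab_group_add \<Rightarrow> 'v) \<Rightarrow> nat \<Rightarrow> nat \<Rightarrow> ('v list \<Rightarrow> 'w list \<Rightarrow> 'v) \<Rightarrow>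
   ('v \<times> 'w::ab_group_add) list \<Rightarrow> 'v \<times> 'w" where
  "emb_left sV k l F = (\<lambda>zs. (summand_ext sV k l F zs, 0))"

definition emb_right ::
  "('k::field \<Rightarrow> 'w::ab_group_add \<Rightarrow> 'w) \<Rightarrow> nat \<Rightarrow> nat \<Rightarrow> ('v list \<Rightarrow> 'w list \<Rightarrow> 'w) \<Rightarrow>
   ('v::ab_group_add \<times> 'w) list \<Rightarrow> 'v \<times> 'w" where
  "emb_right sW k l F = (\<lambda>zs. (0, summand_ext sW k l F zs))"

text \<open>The natural injection of \<open>Hom(\<wedge>V, W)\<close> and the projection onto it.\<close>

definition iota_A ::
  "('k::field \<Rightarrow> 'w::ab_group_add \<Rightarrow> 'w) \<Rightarrow> ('v::ab_group_add list \<Rightarrow> 'w) \<Rightarrow>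
   ('v \<times> 'w) list \<Rightarrow> 'v \<times> 'w" where
  "iota_A sW f = (\<lambda>zs. emb_right sW (length zs) 0 (\<lambda>xs ys. f xs) zs)"

definition proj_A ::
  "(('v::ab_group_add \<times> 'w::ab_group_add) list \<Rightarrow> 'v \<times> 'w) \<Rightarrow> 'v list \<Rightarrow> 'w" where
  "proj_A F = (\<lambda>xs. snd (F (map (\<lambda>x. (x, 0)) xs)))"


section \<open>The absolute datum\<close>

text \<open>Both copies of \<open>\<gg>\<close> are modelled by the same type. The \<open>i\<close>-th summand is \<open>f\<^sub>i\<close>; the
  component of \<open>f\<close> of degree \<open>n\<close> acts on lists of length \<open>n + 1\<close>.\<close>

definition iota_M ::
  "('k::field \<Rightarrow> 'g::ab_group_add \<Rightarrow> 'g) \<Rightarrow> ('g list \<Rightarrow> 'g) \<Rightarrow> ('g \<times> 'g) list \<Rightarrow> 'g \<times> 'g" where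
  "iota_M s f = (\<lambda>zs.
     emb_left s (length zs) 0 (\<lambda>xs ys. f (xs @ ys)) zs +
     (\<Sum>i = 1..length zs. emb_right s (length zs - i) i (\<lambda>xs ys. f (xs @ ys)) zs))"

definition absolute_datum ::
  "('k::field \<Rightarrow> 'g::ab_group_add \<Rightarrow> 'g) \<Rightarrow>
   ('k, ('g \<times> 'g) list \<Rightarrow> 'g \<times> 'g, 'g list \<Rightarrow> 'g, 'g list \<Rightarrow> 'g) V_datum" where
  "absolute_datum s =
     \<lparr> dL = NR_algebra (module_prod.scale s s),
       dM = NR_algebra s, iM = iota_M s,
       dA = abelian_Hom s s, iA = iota_A s,
       dP = proj_A, dDelta = 0 \<rparr>"


section \<open>The relative datum\<close>

text \<open>\<open>M'\<close> is the internal direct sum, inside \<open>L'\<close>, of the summands \<open>Hom(\<wedge>\<gg>, \<gg>)\<close>,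
  \<open>Hom(\<wedge>\<gg> \<otimes> \<wedge>\<hh>, \<hh>)\<close> and \<open>Hom(\<wedge>\<hh>, \<hh>)\<close>, so that its bracket is that of \<open>L'\<close> and
  \<open>\<iota>\<^bsub>M'\<^esub>\<close> is the inclusion.\<close>

definition relative_M_comp ::
  "('k::field \<Rightarrow> 'g::ab_group_add \<Rightarrow> 'g) \<Rightarrow> ('k \<Rightarrow> 'h::ab_group_add \<Rightarrow> 'h) \<Rightarrow> int \<Rightarrow>
   (('g \<times> 'h) list \<Rightarrow> 'g \<times> 'h) set" where
  "relative_M_comp sg sh n =
     (if n \<ge> 0 then
        let N = nat n + 1 in
        {emb_left sg N 0 a + (\<Sum>l = 1..<N. emb_right sh (N - l) l (b l)) + emb_right sh 0 N c
         | a b c. a \<in> wedge_tensor_hom sg sh sg N 0 \<and>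
                  (\<forall>l\<in>{1..<N}. b l \<in> wedge_tensor_hom sg sh sh (N - l) l) \<and>
                  c \<in> wedge_tensor_hom sg sh sh 0 N}
      else {0})"

definition relative_datum ::
  "('k::field \<Rightarrow> 'g::ab_group_add \<Rightarrow> 'g) \<Rightarrow> ('k \<Rightarrow> 'h::ab_group_add \<Rightarrow> 'h) \<Rightarrow>
   ('k, ('g \<times> 'h) list \<Rightarrow> 'g \<times> 'h, ('g \<times> 'h) list \<Rightarrow> 'g \<times> 'h, 'g list \<Rightarrow> 'h) V_datum" where
  "relative_datum sg sh =
     \<lparr> dL = NR_algebra (module_prod.scale sg sh),
       dM = \<lparr> gscale = Hom_scale (module_prod.scale sg sh),
              gcomp = relative_M_comp sg sh,
              gbr = NR_bracket (module_prod.scale sg sh) \<rparr>,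
       iM = id,
       dA = abelian_Hom sg sh, iA = iota_A sh,
       dP = proj_A, dDelta = 0 \<rparr>"

end

theory Submission
  imports Defs
begin

text \<open>
  A signed sum over shuffles satisfies a recursion on the argument list (the first argument goes
  into the first or into the second block), so coassociativity and graded cocommutativity of
  unshuffling follow by induction. They give the graded pre-Lie identity for the insertion
  operation, hence the graded Jacobi identity of the Nijenhuis-Richardson bracket over any field.

  In the coordinates \<open>(x, y) \<mapsto> (x, x + y)\<close> of \<open>\<gg> \<oplus> \<gg>'\<close> the map \<open>\<iota>\<^sub>M(f)\<close> is \<open>f \<times> f\<close>: expanding
  \<open>f(x\<^sub>1 + y\<^sub>1, \<dots>, x\<^sub>n + y\<^sub>n)\<close> over shuffles yields precisely the summands \<open>f\<^sub>i\<close>. As brackets are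
  natural along linear maps intertwining their arguments, \<open>\<iota>\<^sub>M\<close> is an injective homomorphism.

  The space \<open>M'\<close> consists of the operations on \<open>\<gg> \<oplus> \<hh>\<close> that descend along the projection to \<open>\<gg>\<close>
  and restrict to \<open>\<gg>\<close>. Both conditions are stable under the bracket, again by naturality, and
  \<open>\<iota>\<^sub>M(f)\<close> satisfies them. Since the operations on \<open>sM \<oplus> A\<close> only involve \<open>\<iota>\<^sub>M\<close>, \<open>\<iota>\<^sub>A\<close>, \<open>P\<close> and the
  brackets, which all correspond, the induced map commutes with them.
\<close>

section \<open>Signed sums over unshuffles\<close>

text \<open>The factor (-1)^n without a scalar: the combinatorics of signs then takes place in an
  arbitrary abelian group, independently of the field.\<close>

definition signed :: "nat \<Rightarrow> 'a::ab_group_add \<Rightarrow> 'a" where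
  "signed n a = (if even n then a else - a)"

text \<open>The sum of \<open>\<plusminus> H as bs\<close> over all splittings of a list into a first block \<open>as\<close> of length \<open>k\<close> and
  a second block \<open>bs\<close>. An element put into the second block is moved past all \<open>k\<close> elements of
  the first one, whence the sign.\<close>

fun unshuffle_sum :: "nat \<Rightarrow> 'v list \<Rightarrow> ('v list \<Rightarrow> 'v list \<Rightarrow> 'a::ab_group_add) \<Rightarrow> 'a" where
  "unshuffle_sum 0 [] H = H [] []"
| "unshuffle_sum (Suc k) [] H = 0"
| "unshuffle_sum 0 (x # xs) H = unshuffle_sum 0 xs (\<lambda>as bs. H as (x # bs))"
| "unshuffle_sum (Suc k) (x # xs) H =
     unshuffle_sum k xs (\<lambda>as. H (x # as)) +
     signed (Suc k) (unshuffle_sum (Suc k) xs (\<lambda>as bs. H as (x # bs)))"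

text \<open>Only blocks that really occur are compared. This lets identities that depend on the
  block lengths, such as arity conditions and signs of moves, be applied under the sum.\<close>

lemma unshuffle_sum_cong:
  assumes "\<And>as bs. length as = k \<Longrightarrow> length as + length bs = length xs \<Longrightarrow>
    set as \<union> set bs \<subseteq> set xs \<Longrightarrow> H as bs = H' as bs"
  shows "unshuffle_sum k xs H = unshuffle_sum k xs H'"
  using assms
proof (induction k xs H arbitrary: H' rule: unshuffle_sum.induct)
  case (3 x xs H)
  show ?case unfolding unshuffle_sum.simps by (rule 3) (auto intro!: 3(2))
next
  case (4 k x xs H)
  have a: "unshuffle_sum k xs (\<lambda>as. H (x # as)) = unshuffle_sum k xs (\<lambda>as. H' (x # as))"
    by (rule 4(1)) (auto intro!: 4(3))
  have b: "unshuffle_sum (Suc k) xs (\<lambda>as bs. H as (x # bs)) =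
      unshuffle_sum (Suc k) xs (\<lambda>as bs. H' as (x # bs))"
    by (rule 4(2)) (auto intro!: 4(3))
  show ?case unfolding unshuffle_sum.simps a b ..
qed auto

lemma unshuffle_sum_zero [simp]: "unshuffle_sum k xs (\<lambda>_ _. 0) = 0"
proof (induction xs arbitrary: k)
  case Nil
  show ?case by (cases k) auto
next
  case (Cons x xs)
  then show ?case by (cases k) (auto simp: signed_def)
qed

lemma unshuffle_sum_eq_0:
  assumes "\<And>as bs. length as = k \<Longrightarrow> length as + length bs = length xs \<Longrightarrow>
    set as \<union> set bs \<subseteq> set xs \<Longrightarrow> H as bs = 0"
  shows "unshuffle_sum k xs H = 0"
  using unshuffle_sum_cong[of k xs H "\<lambda>_ _. 0"] assms by simp

lemma unshuffle_sum_add: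
  "unshuffle_sum k xs (\<lambda>as bs. H as bs + H' as bs) = unshuffle_sum k xs H + unshuffle_sum k xs H'"
proof (induction xs arbitrary: k H H')
  case Nil
  show ?case by (cases k) auto
next
  case (Cons x xs)
  then show ?case by (cases k) (auto simp: signed_def)
qed

lemma unshuffle_sum_additive:
  assumes "Modules.additive \<phi>"
  shows "\<phi> (unshuffle_sum k xs H) = unshuffle_sum k xs (\<lambda>as bs. \<phi> (H as bs))"
  by (induction k xs H rule: unshuffle_sum.induct)
    (auto simp: signed_def additive.add[OF assms] additive.minus[OF assms] additive.zero[OF assms])

lemma unshuffle_sum_uminus:
  "unshuffle_sum k xs (\<lambda>as bs. - H as bs) = - unshuffle_sum k xs H"
  by (rule unshuffle_sum_additive[symmetric]) (auto intro: additive.intro)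

lemma unshuffle_sum_diff:
  "unshuffle_sum k xs (\<lambda>as bs. H as bs - H' as bs) = unshuffle_sum k xs H - unshuffle_sum k xs H'"
  using unshuffle_sum_add[of k xs H "\<lambda>as bs. - H' as bs"] by (simp add: unshuffle_sum_uminus)

lemma unshuffle_sum_signed:
  "unshuffle_sum k xs (\<lambda>as bs. signed n (H as bs)) = signed n (unshuffle_sum k xs H)"
  by (simp add: signed_def unshuffle_sum_uminus)

lemma unshuffle_sum_map:
  "unshuffle_sum k (map \<phi> xs) H = unshuffle_sum k xs (\<lambda>as bs. H (map \<phi> as) (map \<phi> bs))"
  by (induction k xs "\<lambda>as bs. H (map \<phi> as) (map \<phi> bs)" arbitrary: H rule: unshuffle_sum.induct) auto

lemma unshuffle_sum_0: "unshuffle_sum 0 xs H = H [] xs"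
  by (induction xs arbitrary: H) auto

lemma unshuffle_sum_gt: "length xs < k \<Longrightarrow> unshuffle_sum k xs H = 0"
  by (rule unshuffle_sum_eq_0) auto

lemma unshuffle_sum_length: "unshuffle_sum (length xs) xs H = H xs []"
  by (induction xs arbitrary: H) (auto simp: unshuffle_sum_gt signed_def)

lemma signed_add: "signed n (a + b) = signed n a + signed n b"
  by (simp add: signed_def)

lemma signed_signed: "signed m (signed n a) = signed (m + n) a"
  by (simp add: signed_def)

text \<open>Both sides run over the splittings of \<open>xs\<close> into three blocks, the first two
  of lengths \<open>k\<close> and \<open>l\<close>. In the induction the head enters one of the
  three; on its way to the last it passes \<open>k\<close> and then \<open>l\<close> elements on the
  left, and \<open>k + l\<close> at once on the right.\<close>

lemma unshuffle_sum_coassoc: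
  "unshuffle_sum k xs (\<lambda>as bs. unshuffle_sum l bs (H as)) =
   unshuffle_sum (k + l) xs (\<lambda>cs ds. unshuffle_sum k cs (\<lambda>as bs. H as bs ds))"
proof (induction xs arbitrary: k l H)
  case Nil
  show ?case by (cases k; cases l) auto
next
  case (Cons x xs)
  show ?case
  proof (cases k)
    case 0
    then show ?thesis by (simp add: unshuffle_sum_0)
  next
    case [simp]: (Suc k')
    show ?thesis
    proof (cases l)
      case [simp]: 0
      \<comment> \<open>The middle block is empty, and the congruence supplies
        \<open>length cs = k\<close>, so the inner sum is the single splitting with everything in
        the first block.\<close>
      have "unshuffle_sum k (x # xs) (\<lambda>cs ds. unshuffle_sum k cs (\<lambda>as bs. H as bs ds)) =
          unshuffle_sum k (x # xs) (\<lambda>cs ds. H cs [] ds)"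
        by (rule unshuffle_sum_cong) (use unshuffle_sum_length in blast)
      then show ?thesis by (simp add: unshuffle_sum_0)
    next
      case [simp]: (Suc l')
      show ?thesis
        using Cons[of k' "Suc l'"] Cons[of "Suc k'" l'] Cons[of "Suc k'" "Suc l'"]
        by (simp add: unshuffle_sum_add unshuffle_sum_signed signed_add signed_signed algebra_simps)
    qed
  qed
qed

text \<open>Exchanging adjacent blocks of lengths \<open>k\<close> and \<open>l\<close> takes
  \<open>k * l\<close> transpositions.\<close>

lemma unshuffle_sum_swap:
  "length xs = k + l \<Longrightarrow>
   unshuffle_sum k xs H = signed (k * l) (unshuffle_sum l xs (\<lambda>bs as. H as bs))"
proof (induction xs arbitrary: k l H)
  case Nil
  then show ?case by (auto simp: signed_def)
next
  case (Cons x xs)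
  show ?case
  proof (cases k)
    case 0
    then show ?thesis using Cons.prems unshuffle_sum_length[of "x # xs" "\<lambda>bs as. H as bs"]
      by (simp add: unshuffle_sum_0 signed_def del: unshuffle_sum.simps)
  next
    case [simp]: (Suc k')
    show ?thesis
    proof (cases l)
      case [simp]: 0
      show ?thesis using Cons.prems unshuffle_sum_length[of "x # xs" H]
        by (simp add: unshuffle_sum_0 signed_def del: unshuffle_sum.simps)
    next
      case [simp]: (Suc l')
      show ?thesis
        using Cons.prems Cons.IH[of k' "Suc l'" "\<lambda>as. H (x # as)"]
          Cons.IH[of "Suc k'" l' "\<lambda>as bs. H as (x # bs)"]
        by (auto simp: signed_def algebra_simps)
    qed
  qed
qed

section \<open>Shuffle permutations\<close>

text \<open>The block sum of the identity of one point with \<tau>: the head of the list stays in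
  front.\<close>

definition perm_lift :: "(nat \<Rightarrow> nat) \<Rightarrow> nat \<Rightarrow> nat" where
  "perm_lift \<tau> n = (case n of 0 \<Rightarrow> 0 | Suc m \<Rightarrow> Suc (\<tau> m))"

text \<open>The cycle (0 1 ... i). Composing with it on the right accounts for a head that is placed
  at position \<open>i\<close>, the start of the second block.\<close>

definition perm_cycle :: "nat \<Rightarrow> nat \<Rightarrow> nat" where
  "perm_cycle i m = (if m < i then Suc m else if m = i then 0 else m)"

lemma perm_lift_simps [simp]: "perm_lift \<tau> 0 = 0" "perm_lift \<tau> (Suc m) = Suc (\<tau> m)"
  by (simp_all add: perm_lift_def)

lemma perm_lift_permutes_iff: "perm_lift \<tau> permutes {..<Suc n} \<longleftrightarrow> \<tau> permutes {..<n}"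
proof
  assume *: "perm_lift \<tau> permutes {..<Suc n}"
  show "\<tau> permutes {..<n}"
  proof (rule inj_imp_permutes)
    show "inj_on \<tau> {..<n}"
      using permutes_inj[OF *] by (metis inj_onI injD nat.inject perm_lift_simps(2))
    show "\<tau> x \<in> {..<n}" if "x \<in> {..<n}" for x
      using permutes_in_image[OF *, of "Suc x"] that by simp
    show "\<tau> x = x" if "x \<notin> {..<n}" for x
      using permutes_not_in[OF *, of "Suc x"] that by simp
  qed simp
next
  assume *: "\<tau> permutes {..<n}"
  show "perm_lift \<tau> permutes {..<Suc n}"
  proof (rule inj_imp_permutes)
    show "inj_on (perm_lift \<tau>) {..<Suc n}"
      using permutes_inj[OF *] by (intro inj_onI) (auto simp: perm_lift_def inj_eq split: nat.splits)
    show "perm_lift \<tau> x \<in> {..<Suc n}" if "x \<in> {..<Suc n}" for x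
      using permutes_in_image[OF *, of "x - 1"] that by (cases x) auto
    show "perm_lift \<tau> x = x" if "x \<notin> {..<Suc n}" for x
      using permutes_not_in[OF *, of "x - 1"] that by (cases x) auto
  qed simp
qed

lemma perm_lift_exists:
  assumes "\<sigma> permutes {..<Suc n}" "\<sigma> 0 = 0"
  obtains \<tau> where "\<sigma> = perm_lift \<tau>"
proof
  have "\<sigma> (Suc m) \<noteq> 0" for m
    using permutes_inj[OF assms(1)] assms(2) by (metis injD nat.distinct(1))
  then show "\<sigma> = perm_lift (\<lambda>m. \<sigma> (Suc m) - 1)"
    using assms(2) by (auto simp: perm_lift_def fun_eq_iff split: nat.split)
qed

text \<open>The lift is the transport of \<tau> along the injection \<open>Suc\<close>, and
  transport preserves the sign.\<close>

lemma sign_perm_lift: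
  assumes "\<tau> permutes {..<n}"
  shows "sign (perm_lift \<tau>) = sign \<tau>"
proof -
  have "perm_lift \<tau> = map_permutation {..<n} Suc \<tau>"
  proof
    fix x
    have p: "map_permutation {..<n} Suc \<tau> permutes Suc ` {..<n}"
      using assms by (intro map_permutation_permutes) (auto simp: bij_betw_def)
    show "perm_lift \<tau> x = map_permutation {..<n} Suc \<tau> x"
    proof (cases "x \<in> Suc ` {..<n}")
      case True
      then show ?thesis by (auto simp: map_permutation_apply)
    next
      case False
      then have "perm_lift \<tau> x = x"
        using permutes_not_in[OF assms, of "x - 1"] by (cases x) auto
      then show ?thesis using permutes_not_in[OF p False] by simp
    qed
  qed
  then show ?thesis using assms by (simp add: sign_map_permutation)
qed

text \<open>Builds the cycle from adjacent transpositions, one for each position passed, which gives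
  its sign.\<close>

lemma perm_cycle_Suc: "perm_cycle (Suc i) = perm_cycle i \<circ> transpose i (Suc i)"
  by (auto simp: fun_eq_iff perm_cycle_def transpose_def)

lemma perm_cycle_0: "perm_cycle 0 = id"
  by (auto simp: fun_eq_iff perm_cycle_def)

lemma perm_cycle_permutes: "perm_cycle i permutes {..i}"
proof (induction i)
  case (Suc i)
  then show ?case unfolding perm_cycle_Suc
    by (intro permutes_compose permutes_swap_id permutes_subset[OF Suc]) auto
qed (auto simp: perm_cycle_0 permutes_id simp flip: id_def)

lemma sign_perm_cycle: "sign (perm_cycle i) = (- 1) ^ i"
proof (induction i)
  case (Suc i)
  have "permutation (perm_cycle i)"
    using perm_cycle_permutes[of i] permutation_permutes by blast
  then show ?case unfolding perm_cycle_Suc using Suc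
    by (simp add: sign_compose permutation_swap_id sign_swap_id del: o_apply)
qed (simp add: perm_cycle_0)

text \<open>A shuffle attains \<open>0\<close> at the beginning of one of its two blocks. Deleting that position
  mirrors the recursion of \<open>unshuffle_sum\<close>.\<close>

lemma Sh_fix_0: "{\<sigma> \<in> Sh (Suc i) j. \<sigma> 0 = 0} = perm_lift ` Sh i j"
proof (intro equalityI subsetI)
  fix \<sigma> assume "\<sigma> \<in> {\<sigma> \<in> Sh (Suc i) j. \<sigma> 0 = 0}"
  then have s: "\<sigma> permutes {..<Suc (i + j)}" "\<sigma> 0 = 0" "strict_mono_on {..<Suc i} \<sigma>"
      "strict_mono_on {Suc i..<Suc (i + j)} \<sigma>"
    by (auto simp: Sh_def)
  obtain \<tau> where t: "\<sigma> = perm_lift \<tau>" using perm_lift_exists[OF s(1,2)] .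
  have "\<tau> permutes {..<i + j}" using s(1) perm_lift_permutes_iff t by simp
  moreover have "\<tau> a < \<tau> b" if "a < b" "b < i" for a b
    using strict_mono_onD[OF s(3), of "Suc a" "Suc b"] that by (simp add: t)
  moreover have "\<tau> a < \<tau> b" if "i \<le> a" "a < b" "b < i + j" for a b
    using strict_mono_onD[OF s(4), of "Suc a" "Suc b"] that by (simp add: t)
  ultimately have "\<tau> \<in> Sh i j" by (auto simp: Sh_def intro!: strict_mono_onI)
  then show "\<sigma> \<in> perm_lift ` Sh i j" using t by blast
next
  fix \<sigma> assume "\<sigma> \<in> perm_lift ` Sh i j"
  then obtain \<tau> where t: "\<sigma> = perm_lift \<tau>" "\<tau> permutes {..<i + j}" "strict_mono_on {..<i} \<tau>"
      "strict_mono_on {i..<i + j} \<tau>"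
    by (auto simp: Sh_def)
  have "\<sigma> permutes {..<Suc i + j}" using t by (simp add: perm_lift_permutes_iff)
  moreover have "\<sigma> a < \<sigma> b" if "a < b" "b < Suc i" for a b
    using strict_mono_onD[OF t(3), of "a - 1" "b - 1"] that
    by (cases a; cases b) (auto simp: t(1))
  moreover have "\<sigma> a < \<sigma> b" if "Suc i \<le> a" "a < b" "b < Suc i + j" for a b
    using strict_mono_onD[OF t(4), of "a - 1" "b - 1"] that
    by (cases a; cases b) (auto simp: t(1))
  ultimately show "\<sigma> \<in> {\<sigma> \<in> Sh (Suc i) j. \<sigma> 0 = 0}"
    by (auto simp: Sh_def t(1) intro!: strict_mono_onI)
qed

text \<open>The factor \<open>perm_cycle i\<close> brings position \<open>i\<close> to the front and
  keeps the other positions in order. What remains fixes 0 and is therefore a lift.\<close>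

lemma Sh_fix_Suc:
  "{\<sigma> \<in> Sh i (Suc j). \<sigma> i = 0} = (\<lambda>\<tau>. perm_lift \<tau> \<circ> perm_cycle i) ` Sh i j"
proof (intro equalityI subsetI)
  fix \<sigma> assume "\<sigma> \<in> {\<sigma> \<in> Sh i (Suc j). \<sigma> i = 0}"
  then have s: "\<sigma> permutes {..<Suc (i + j)}" "\<sigma> i = 0" "strict_mono_on {..<i} \<sigma>"
      "strict_mono_on {i..<Suc (i + j)} \<sigma>"
    by (auto simp: Sh_def)
  have c: "perm_cycle i permutes {..<Suc (i + j)}"
    by (rule permutes_subset[OF perm_cycle_permutes]) auto
  have inv: "inv (perm_cycle i) (perm_cycle i m) = m" for m
    using permutes_inverses(2)[OF c] .
  have "\<sigma> \<circ> inv (perm_cycle i) permutes {..<Suc (i + j)}"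
    by (rule permutes_compose[OF permutes_inv[OF c] s(1)])
  moreover have "(\<sigma> \<circ> inv (perm_cycle i)) 0 = 0"
    using s(2) inv[of i] by (simp add: perm_cycle_def)
  ultimately obtain \<tau> where "\<sigma> \<circ> inv (perm_cycle i) = perm_lift \<tau>"
      and p: "perm_lift \<tau> permutes {..<Suc (i + j)}"
    using perm_lift_exists by metis
  then have t: "\<sigma> = perm_lift \<tau> \<circ> perm_cycle i"
    using inv by (auto simp: fun_eq_iff) metis
  have "\<tau> a < \<tau> b" if "a < b" "b < i" for a b
    using strict_mono_onD[OF s(3), of a b] that by (simp add: t perm_cycle_def)
  moreover have "\<tau> a < \<tau> b" if "i \<le> a" "a < b" "b < i + j" for a b
    using strict_mono_onD[OF s(4), of "Suc a" "Suc b"] that by (simp add: t perm_cycle_def)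
  ultimately have "\<tau> \<in> Sh i j" using p
    by (auto simp: Sh_def perm_lift_permutes_iff intro!: strict_mono_onI)
  then show "\<sigma> \<in> (\<lambda>\<tau>. perm_lift \<tau> \<circ> perm_cycle i) ` Sh i j" using t by blast
next
  fix \<sigma> assume "\<sigma> \<in> (\<lambda>\<tau>. perm_lift \<tau> \<circ> perm_cycle i) ` Sh i j"
  then obtain \<tau> where t: "\<sigma> = perm_lift \<tau> \<circ> perm_cycle i" "\<tau> permutes {..<i + j}"
      "strict_mono_on {..<i} \<tau>" "strict_mono_on {i..<i + j} \<tau>"
    by (auto simp: Sh_def)
  have c: "perm_cycle i permutes {..<Suc (i + j)}"
    by (rule permutes_subset[OF perm_cycle_permutes]) auto
  have "\<sigma> permutes {..<i + Suc j}"
    using permutes_compose[OF c] t by (simp add: perm_lift_permutes_iff)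
  moreover have "\<sigma> a < \<sigma> b" if "a < b" "b < i" for a b
    using strict_mono_onD[OF t(3), of a b] that by (simp add: t(1) perm_cycle_def)
  moreover have "\<sigma> a < \<sigma> b" if "i \<le> a" "a < b" "b < i + Suc j" for a b
    using strict_mono_onD[OF t(4), of "a - 1" "b - 1"] that
    by (cases a; cases b) (auto simp: t(1) perm_cycle_def)
  ultimately show "\<sigma> \<in> {\<sigma> \<in> Sh i (Suc j). \<sigma> i = 0}"
    by (auto simp: Sh_def t(1) perm_cycle_def intro!: strict_mono_onI)
qed

text \<open>The preimage of 0 lies in one of the two blocks, and monotonicity there forces it to be
  the first position of that block.\<close>

lemma Sh_decomp:
  "Sh i j = {\<sigma> \<in> Sh i j. 0 < i \<and> \<sigma> 0 = 0} \<union> {\<sigma> \<in> Sh i j. 0 < j \<and> \<sigma> i = 0}" if "0 < i + j"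
proof -
  have "0 < i \<and> \<sigma> 0 = 0 \<or> 0 < j \<and> \<sigma> i = 0" if s: "\<sigma> \<in> Sh i j" for \<sigma>
  proof -
    have p: "\<sigma> permutes {..<i + j}" "strict_mono_on {..<i} \<sigma>" "strict_mono_on {i..<i + j} \<sigma>"
      using s by (auto simp: Sh_def)
    obtain m where m: "\<sigma> m = 0" using permutes_surj[OF p(1)] by (metis surjD)
    then have "m < i + j" using permutes_not_in[OF p(1), of m] \<open>0 < i + j\<close> by fastforce
    show ?thesis
    proof (cases "m < i")
      case True
      then have "m = 0" using strict_mono_onD[OF p(2), of 0 m] m by auto
      then show ?thesis using True m by auto
    next
      case False
      then have "m = i" using strict_mono_onD[OF p(3), of i m] m \<open>m < i + j\<close> by force
      then show ?thesis using \<open>m < i + j\<close> m by auto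
    qed
  qed
  then show ?thesis by blast
qed

lemma finite_Sh: "finite (Sh i j)"
  by (rule finite_subset[OF _ finite_permutations[of "{..<i + j}"]]) (auto simp: Sh_def)

lemma permutation_Sh: "\<sigma> \<in> Sh i j \<Longrightarrow> \<sigma> permutes {..<i + j}" "\<sigma> \<in> Sh i j \<Longrightarrow> permutation \<sigma>"
  by (auto simp: Sh_def permutation_permutes)

text \<open>The action of the sign on an abelian group. It replaces the scalar
  \<open>of_int (sign \<sigma>)\<close> of the definitions, see \<open>scale_sign\<close>.\<close>

definition sgn_perm :: "(nat \<Rightarrow> nat) \<Rightarrow> 'a::ab_group_add \<Rightarrow> 'a" where
  "sgn_perm \<sigma> a = (if sign \<sigma> = 1 then a else - a)"

lemma scale_sign:
  assumes "vector_space sX"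
  shows "sX (of_int (sign \<sigma>)) v = sgn_perm \<sigma> v"
proof -
  interpret vector_space sX by fact
  show ?thesis by (cases \<sigma> rule: sign_cases) (simp_all add: sgn_perm_def)
qed

lemma sgn_perm_lift: "\<tau> \<in> Sh i j \<Longrightarrow> sgn_perm (perm_lift \<tau>) a = sgn_perm \<tau> a"
  using permutation_Sh(1) sign_perm_lift by (metis sgn_perm_def)

lemma sgn_perm_lift_cycle:
  assumes "\<tau> \<in> Sh i j"
  shows "sgn_perm (perm_lift \<tau> \<circ> perm_cycle i) a = signed i (sgn_perm \<tau> a)"
proof -
  have "perm_lift \<tau> permutes {..<Suc (i + j)}"
    using permutation_Sh(1)[OF assms] by (simp add: perm_lift_permutes_iff)
  moreover have "perm_cycle i permutes {..i}" by (rule perm_cycle_permutes)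
  ultimately have "permutation (perm_lift \<tau>)" "permutation (perm_cycle i)"
    using permutation_permutes finite_atMost finite_lessThan by blast+
  then have "sign (perm_lift \<tau> \<circ> perm_cycle i) = sign \<tau> * (- 1) ^ i"
    using permutation_Sh(1)[OF assms] by (simp add: sign_compose sign_perm_lift sign_perm_cycle)
  then show ?thesis
    by (cases \<tau> rule: sign_cases) (auto simp: sgn_perm_def signed_def minus_one_power_iff)
qed

lemma inj_perm_lift: "inj perm_lift"
  by (rule injI) (metis ext nat.inject perm_lift_simps(2))

lemma inj_perm_lift_cycle: "inj (\<lambda>\<tau>. perm_lift \<tau> \<circ> perm_cycle i)"
proof (rule injI)
  fix \<tau> \<tau>' assume "perm_lift \<tau> \<circ> perm_cycle i = perm_lift \<tau>' \<circ> perm_cycle i"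
  then have "perm_lift \<tau> = perm_lift \<tau>'"
    using permutes_surj[OF perm_cycle_permutes[of i]]
    by (auto simp: fun_eq_iff) (metis surjD)
  then show "\<tau> = \<tau>'" using inj_perm_lift by (auto dest: injD)
qed

lemma map_upt_Suc_shift: "map f [Suc i..<Suc j] = map (\<lambda>m. f (Suc m)) [i..<j]"
  by (simp add: map_Suc_upt[symmetric] del: upt_Suc)

text \<open>The bridge between shuffles as permutations and the list recursion. Shuffles with
  \<open>\<sigma> 0 = 0\<close> give the summand with the head in the first block, those with
  \<open>\<sigma> i = 0\<close> the one with the head in the second block, where the sign of
  \<open>perm_cycle i\<close> becomes the factor \<open>signed i\<close>.\<close>

lemma sum_Sh:
  assumes "length xs = i + j"
  shows "(\<Sum>\<sigma>\<in>Sh i j. sgn_perm \<sigma>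
      (H (map (\<lambda>m. xs ! \<sigma> m) [0..<i]) (map (\<lambda>m. xs ! \<sigma> m) [i..<i + j]))) = unshuffle_sum i xs H"
  using assms
proof (induction xs arbitrary: i j H)
  case Nil
  then have "Sh i j = {id}" by (auto simp: Sh_def strict_mono_on_def permutes_id)
  with Nil show ?case by (simp add: sgn_perm_def)
next
  case (Cons x xs)
  let ?F = "\<lambda>i j \<sigma>. sgn_perm \<sigma>
    (H (map (\<lambda>m. (x # xs) ! \<sigma> m) [0..<i]) (map (\<lambda>m. (x # xs) ! \<sigma> m) [i..<i + j]))"
  have A: "sum (?F (Suc k) j) {\<sigma> \<in> Sh (Suc k) j. \<sigma> 0 = 0} = unshuffle_sum k xs (\<lambda>as. H (x # as))"
    if "length xs = k + j" for k j
  proof -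
    have "sum (?F (Suc k) j) {\<sigma> \<in> Sh (Suc k) j. \<sigma> 0 = 0} =
        (\<Sum>\<tau>\<in>Sh k j. ?F (Suc k) j (perm_lift \<tau>))"
      unfolding Sh_fix_0 by (rule sum.reindex_cong) (use inj_perm_lift in \<open>auto intro: inj_on_subset\<close>)
    also have "\<dots> = (\<Sum>\<tau>\<in>Sh k j. sgn_perm \<tau>
        (H (x # map (\<lambda>m. xs ! \<tau> m) [0..<k]) (map (\<lambda>m. xs ! \<tau> m) [k..<k + j])))"
      by (rule sum.cong)
        (auto simp: sgn_perm_lift upt_conv_Cons map_upt_Suc_shift simp del: upt_Suc)
    also have "\<dots> = unshuffle_sum k xs (\<lambda>as. H (x # as))"
      by (rule Cons.IH[OF that])
    finally show ?thesis .
  qed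
  have B: "sum (?F i (Suc l)) {\<sigma> \<in> Sh i (Suc l). \<sigma> i = 0} =
      signed i (unshuffle_sum i xs (\<lambda>as bs. H as (x # bs)))"
    if "length xs = i + l" for i l
  proof -
    have "sum (?F i (Suc l)) {\<sigma> \<in> Sh i (Suc l). \<sigma> i = 0} =
        (\<Sum>\<tau>\<in>Sh i l. ?F i (Suc l) (perm_lift \<tau> \<circ> perm_cycle i))"
      unfolding Sh_fix_Suc
      by (rule sum.reindex_cong) (use inj_perm_lift_cycle in \<open>auto intro: inj_on_subset\<close>)
    also have "\<dots> = (\<Sum>\<tau>\<in>Sh i l. signed i (sgn_perm \<tau>
        (H (map (\<lambda>m. xs ! \<tau> m) [0..<i]) (x # map (\<lambda>m. xs ! \<tau> m) [i..<i + l]))))"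
    proof (rule sum.cong)
      fix \<tau> assume t: "\<tau> \<in> Sh i l"
      have 1: "map (\<lambda>m. (x # xs) ! (perm_lift \<tau> \<circ> perm_cycle i) m) [0..<i] =
          map (\<lambda>m. xs ! \<tau> m) [0..<i]"
        by (rule map_cong) (auto simp: perm_cycle_def)
      have "map (\<lambda>m. (x # xs) ! (perm_lift \<tau> \<circ> perm_cycle i) m) [Suc i..<Suc (i + l)] =
          map (\<lambda>m. xs ! \<tau> m) [i..<i + l]"
        unfolding map_upt_Suc_shift by (rule map_cong) (auto simp: perm_cycle_def)
      then have 2: "map (\<lambda>m. (x # xs) ! (perm_lift \<tau> \<circ> perm_cycle i) m) [i..<i + Suc l] =
          x # map (\<lambda>m. xs ! \<tau> m) [i..<i + l]"
        by (simp add: upt_conv_Cons perm_cycle_def del: upt_Suc)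
      show "?F i (Suc l) (perm_lift \<tau> \<circ> perm_cycle i) = signed i (sgn_perm \<tau>
        (H (map (\<lambda>m. xs ! \<tau> m) [0..<i]) (x # map (\<lambda>m. xs ! \<tau> m) [i..<i + l])))"
        unfolding 1 2 sgn_perm_lift_cycle[OF t] ..
    qed auto
    also have "\<dots> = signed i (unshuffle_sum i xs (\<lambda>as bs. H as (x # bs)))"
      unfolding Cons.IH[OF that, symmetric] by (simp add: signed_def sum_negf)
    finally show ?thesis .
  qed
  show ?case
  proof (cases i)
    case [simp]: 0
    obtain l where [simp]: "j = Suc l" using Cons.prems by (cases j) auto
    \<comment> \<open>With an empty first block the head can only enter the second one.\<close>
    have "Sh i j = {\<sigma> \<in> Sh i (Suc l). \<sigma> i = 0}" using Sh_decomp[of i j] by auto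
    then show ?thesis using B[of i l] Cons.prems by (simp add: signed_def del: upt_Suc)
  next
    case [simp]: (Suc k)
    show ?thesis
    proof (cases j)
      case [simp]: 0
      \<comment> \<open>With an empty second block the other summand of the recursion vanishes too,
        since the tail is too short for a first block of length \<open>Suc k\<close>.\<close>
      have "Sh i j = {\<sigma> \<in> Sh (Suc k) j. \<sigma> 0 = 0}" using Sh_decomp[of i j] by auto
      then show ?thesis using A[of k j] Cons.prems
        by (simp add: signed_def unshuffle_sum_gt del: upt_Suc)
    next
      case [simp]: (Suc l)
      have *: "Sh i j = {\<sigma> \<in> Sh (Suc k) j. \<sigma> 0 = 0} \<union> {\<sigma> \<in> Sh i (Suc l). \<sigma> i = 0}"
        using Sh_decomp[of i j] by auto
      have "\<not> (\<sigma> 0 = 0 \<and> \<sigma> i = 0)" if "\<sigma> \<in> Sh i j" for \<sigma>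
        using injD[OF permutes_inj[OF permutation_Sh(1)[OF that]], of 0 i] \<open>i = Suc k\<close>
        by (metis nat.distinct(1))
      then have **: "{\<sigma> \<in> Sh (Suc k) j. \<sigma> 0 = 0} \<inter> {\<sigma> \<in> Sh i (Suc l). \<sigma> i = 0} = {}"
        by fastforce
      have "sum (?F i j) (Sh i j) = sum (?F i j) {\<sigma> \<in> Sh (Suc k) j. \<sigma> 0 = 0} +
          sum (?F i j) {\<sigma> \<in> Sh i (Suc l). \<sigma> i = 0}"
        by (subst *, rule sum.union_disjoint[OF _ _ **]) (auto simp: finite_Sh)
      also have "\<dots> = unshuffle_sum i (x # xs) H"
        using A[of k j] B[of i l] Cons.prems by (simp del: upt_Suc)
      finally show ?thesis .
    qed
  qed
qed

section \<open>Alternating multilinear maps and the pre-Lie identity\<close>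

text \<open>No arity is fixed, so that sums of forms of several arities are covered. Alternation is
  required for adjacent entries only; \<open>alt_form_eq_0\<close> recovers it for arbitrary
  ones.\<close>

definition alt_form ::
  "('k::field \<Rightarrow> 'v::ab_group_add \<Rightarrow> 'v) \<Rightarrow> ('k \<Rightarrow> 'x::ab_group_add \<Rightarrow> 'x) \<Rightarrow> ('v list \<Rightarrow> 'x) \<Rightarrow> bool" where
  "alt_form sV sX f \<longleftrightarrow>
     (\<forall>as x y bs. f (as @ (x + y) # bs) = f (as @ x # bs) + f (as @ y # bs)) \<and>
     (\<forall>as c x bs. f (as @ sV c x # bs) = sX c (f (as @ x # bs))) \<and>
     (\<forall>as x bs. f (as @ x # x # bs) = 0)"

lemma alt_form_add: "alt_form sV sX f \<Longrightarrow> f (as @ (x + y) # bs) = f (as @ x # bs) + f (as @ y # bs)"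
  and alt_form_scale: "alt_form sV sX f \<Longrightarrow> f (as @ sV c x # bs) = sX c (f (as @ x # bs))"
  and alt_form_alt: "alt_form sV sX f \<Longrightarrow> f (as @ x # x # bs) = 0"
  by (auto simp: alt_form_def)

lemmas alt_form_hd = alt_form_add[where as = "[]", simplified]
  alt_form_scale[where as = "[]", simplified] alt_form_alt[where as = "[]", simplified]

lemma additive_alt_form: "alt_form sV sX f \<Longrightarrow> Modules.additive (\<lambda>x. f (as @ x # bs))"
  by (simp add: additive.intro alt_form_add)

lemma additive_alt_form_hd: "alt_form sV sX f \<Longrightarrow> Modules.additive (\<lambda>x. f (x # bs))"
  using additive_alt_form[where as = "[]"] by auto

lemma alt_form_zero: "alt_form sV sX f \<Longrightarrow> f (as @ 0 # bs) = 0"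
  using additive.zero[OF additive_alt_form] .

lemma alt_form_zero_hd: "alt_form sV sX f \<Longrightarrow> f (0 # bs) = 0"
  using alt_form_zero[where as = "[]"] by auto

lemma alt_form_swap:
  assumes "alt_form sV sX f"
  shows "f (as @ x # y # bs) = - f (as @ y # x # bs)"
proof -
  have "f (as @ (x + y) # (x + y) # bs) =
      f (as @ x # (x + y) # bs) + f (as @ y # (x + y) # bs)"
    by (rule alt_form_add[OF assms])
  also have "\<dots> = f (as @ x # x # bs) + f (as @ x # y # bs) + (f (as @ y # x # bs) + f (as @ y # y # bs))"
    using alt_form_add[OF assms, of "as @ [x]" x y bs] alt_form_add[OF assms, of "as @ [y]" x y bs]
    by simp
  finally show ?thesis by (simp add: alt_form_alt[OF assms] eq_neg_iff_add_eq_0)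
qed

text \<open>One adjacent swap for each entry of \<open>cs\<close>; this is the sign with which
  \<open>unshuffle_sum\<close> puts an element into its second block.\<close>

lemma alt_form_move:
  assumes "alt_form sV sX f"
  shows "f (as @ x # cs @ bs) = signed (length cs) (f (as @ cs @ x # bs))"
proof (induction cs arbitrary: as)
  case (Cons c cs)
  show ?case using Cons[of "as @ [c]"] alt_form_swap[OF assms, of as x c "cs @ bs"]
    by (simp add: signed_def)
qed (simp add: signed_def)

lemma alt_form_eq_0:
  assumes "alt_form sV sX f"
  shows "f (as @ x # cs @ x # bs) = 0"
  using alt_form_move[OF assms, of as x cs "x # bs"] alt_form_alt[OF assms, of "as @ cs" x bs]
  by (simp add: signed_def)

lemma alt_form_append: "alt_form sV sX f \<Longrightarrow> alt_form sV sX (\<lambda>xs. f (us @ xs))"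
  unfolding alt_form_def append_assoc[symmetric] by metis

lemma alt_form_Cons: "alt_form sV sX f \<Longrightarrow> alt_form sV sX (\<lambda>xs. f (u # xs))"
  using alt_form_append[of sV sX f "[u]"] by simp

lemma alt_form_append_right: "alt_form sV sX f \<Longrightarrow> alt_form sV sX (\<lambda>xs. f (xs @ us))"
  unfolding alt_form_def by simp

lemma alt_form_map:
  assumes "alt_form sW sX f" "Vector_Spaces.linear sV sW \<phi>"
  shows "alt_form sV sX (\<lambda>xs. f (map \<phi> xs))"
  using assms by (auto simp: alt_form_def Vector_Spaces.linear_iff)

lemma alt_form_comp:
  assumes "alt_form sV sX f" "Vector_Spaces.linear sX sY \<phi>"
  shows "alt_form sV sY (\<lambda>xs. \<phi> (f xs))"
proof -
  have "\<phi> 0 = 0" using assms(2) by (metis Vector_Spaces.linear_iff add_cancel_right_right)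
  then show ?thesis using assms by (auto simp: alt_form_def Vector_Spaces.linear_iff)
qed

lemma alt_form_0: "vector_space sX \<Longrightarrow> alt_form sV sX (\<lambda>_. 0)"
  by (simp add: alt_form_def module.scale_zero_right module_iff_vector_space)

lemma alt_form_plus:
  "vector_space sX \<Longrightarrow> alt_form sV sX f \<Longrightarrow> alt_form sV sX g \<Longrightarrow> alt_form sV sX (\<lambda>xs. f xs + g xs)"
  by (auto simp: alt_form_def vector_space_def algebra_simps)

lemma alt_form_scaled:
  assumes "vector_space sX" "alt_form sV sX f"
  shows "alt_form sV sX (\<lambda>xs. sX c (f xs))"
proof -
  interpret vector_space sX by fact
  show ?thesis using assms(2) by (auto simp: alt_form_def algebra_simps)
qed

lemma alt_form_uminus:
  assumes "vector_space sX" "alt_form sV sX f"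
  shows "alt_form sV sX (\<lambda>xs. - f xs)"
proof -
  interpret vector_space sX by fact
  show ?thesis using assms(2) by (auto simp: alt_form_def algebra_simps)
qed

lemma alt_form_signed:
  "vector_space sX \<Longrightarrow> alt_form sV sX f \<Longrightarrow> alt_form sV sX (\<lambda>xs. signed n (f xs))"
  by (cases "even n") (simp_all add: signed_def alt_form_uminus)

lemma alt_form_minus:
  "vector_space sX \<Longrightarrow> alt_form sV sX f \<Longrightarrow> alt_form sV sX g \<Longrightarrow> alt_form sV sX (\<lambda>xs. f xs - g xs)"
  using alt_form_plus[OF _ _ alt_form_uminus, of sX sV f g] by simp

text \<open>Induction on the prefix \<open>us\<close>: each of its entries is absorbed into
  \<open>H\<close>, which stays alternating in both blocks, until the slot is the head of the
  list.\<close>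

lemma unshuffle_sum_slot_add:
  assumes "\<And>bs. alt_form sV sX (\<lambda>as. H as bs)" "\<And>as. alt_form sV sX (H as)"
  shows "unshuffle_sum k (us @ (x + y) # vs) H =
    unshuffle_sum k (us @ x # vs) H + unshuffle_sum k (us @ y # vs) H"
  using assms
proof (induction us arbitrary: k H)
  case Nil
  note a = alt_form_hd[OF Nil(1)] alt_form_hd[OF Nil(2)]
  have "(\<lambda>as. H ((x + y) # as)) = (\<lambda>as bs. H (x # as) bs + H (y # as) bs)"
    by (simp add: fun_eq_iff a)
  then show ?case by (cases k) (simp_all add: a unshuffle_sum_add signed_add)
next
  case (Cons u us)
  have 1: "unshuffle_sum k (us @ (x + y) # vs) (\<lambda>as. H (u # as)) =
    unshuffle_sum k (us @ x # vs) (\<lambda>as. H (u # as)) + unshuffle_sum k (us @ y # vs) (\<lambda>as. H (u # as))" for k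
    by (rule Cons.IH) (auto intro: Cons.prems alt_form_Cons)
  have 2: "unshuffle_sum k (us @ (x + y) # vs) (\<lambda>as bs. H as (u # bs)) =
    unshuffle_sum k (us @ x # vs) (\<lambda>as bs. H as (u # bs)) +
    unshuffle_sum k (us @ y # vs) (\<lambda>as bs. H as (u # bs))" for k
    by (rule Cons.IH) (auto intro: Cons.prems alt_form_Cons)
  show ?case by (cases k) (simp_all add: 1 2 signed_add)
qed

lemma unshuffle_sum_slot_scale:
  assumes "vector_space sX" "\<And>bs. alt_form sV sX (\<lambda>as. H as bs)" "\<And>as. alt_form sV sX (H as)"
  shows "unshuffle_sum k (us @ sV c x # vs) H = sX c (unshuffle_sum k (us @ x # vs) H)"
  using assms(2-)
proof (induction us arbitrary: k H)
  interpret vector_space sX by fact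
  have add: "Modules.additive (sX c)" by (simp add: additive.intro algebra_simps)
  have sg: "sX c (signed n a) = signed n (sX c a)" for n a
    by (simp add: signed_def)
  {
    case Nil
    note a = alt_form_hd[OF Nil(1)] alt_form_hd[OF Nil(2)]
    have "(\<lambda>as. H (sV c x # as)) = (\<lambda>as bs. sX c (H (x # as) bs))"
      by (simp add: fun_eq_iff a)
    then show ?case
      by (cases k) (simp_all add: a unshuffle_sum_additive[OF add] sg scale_right_distrib)
  next
    case (Cons u us)
    have 1: "unshuffle_sum k (us @ sV c x # vs) (\<lambda>as. H (u # as)) =
      sX c (unshuffle_sum k (us @ x # vs) (\<lambda>as. H (u # as)))" for k
      by (rule Cons.IH) (auto intro: Cons.prems alt_form_Cons)
    have 2: "unshuffle_sum k (us @ sV c x # vs) (\<lambda>as bs. H as (u # bs)) =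
      sX c (unshuffle_sum k (us @ x # vs) (\<lambda>as bs. H as (u # bs)))" for k
      by (rule Cons.IH) (auto intro: Cons.prems alt_form_Cons)
    show ?case by (cases k) (simp_all add: 1 2 sg scale_right_distrib)
  }
qed

text \<open>Two equal neighbours in the same block give 0. The two ways of separating them differ by
  one transposition and cancel.\<close>

lemma unshuffle_sum_slot_alt:
  assumes "\<And>bs. alt_form sV sX (\<lambda>as. H as bs)" "\<And>as. alt_form sV sX (H as)"
  shows "unshuffle_sum k (us @ x # x # vs) H = 0"
  using assms
proof (induction us arbitrary: k H)
  case Nil
  note a = alt_form_hd(3)[OF Nil(1)] alt_form_hd(3)[OF Nil(2)]
  show ?case
  proof (cases k)
    case (Suc k')
    moreover have "(\<lambda>as. H (x # x # as)) = (\<lambda>_ _. 0)"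
      by (simp add: fun_eq_iff a)
    ultimately show ?thesis by (cases k') (simp_all add: a signed_def)
  qed (simp add: a)
next
  case (Cons u us)
  have 1: "unshuffle_sum k (us @ x # x # vs) (\<lambda>as. H (u # as)) = 0" for k
    by (rule Cons.IH) (auto intro: Cons.prems alt_form_Cons)
  have 2: "unshuffle_sum k (us @ x # x # vs) (\<lambda>as bs. H as (u # bs)) = 0" for k
    by (rule Cons.IH) (auto intro: Cons.prems alt_form_Cons)
  show ?case by (cases k) (simp_all add: 1 2 signed_def)
qed

lemma alt_form_unshuffle_sum:
  assumes "vector_space sX" "\<And>bs. alt_form sV sX (\<lambda>as. H as bs)" "\<And>as. alt_form sV sX (H as)"
  shows "alt_form sV sX (\<lambda>xs. unshuffle_sum k xs H)"
  using unshuffle_sum_slot_add[of sV sX H, OF assms(2,3)]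
    unshuffle_sum_slot_scale[of sX sV H, OF assms] unshuffle_sum_slot_alt[of sV sX H, OF assms(2,3)]
  by (simp add: alt_form_def)

text \<open>Replaces conditions on positions by conditions on list decompositions. At lengths other
  than \<open>k\<close> the latter hold because every term is 0.\<close>

lemma wedge_hom_iff:
  assumes "vector_space sV" "vector_space sX"
  shows "f \<in> wedge_hom sV sX k \<longleftrightarrow> alt_form sV sX f \<and> (\<forall>xs. length xs \<noteq> k \<longrightarrow> f xs = 0)"
proof (intro iffI conjI)
  assume f: "f \<in> wedge_hom sV sX k"
  then have slot: "\<And>xs i. length xs = k \<Longrightarrow> i < k \<Longrightarrow> Vector_Spaces.linear sV sX (\<lambda>x. f (xs[i := x]))"
    and alt: "\<And>xs i j. length xs = k \<Longrightarrow> i < j \<Longrightarrow> j < k \<Longrightarrow> xs ! i = xs ! j \<Longrightarrow> f xs = 0"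
    unfolding wedge_hom_def by blast+
  show len: "\<forall>xs. length xs \<noteq> k \<longrightarrow> f xs = 0" using f unfolding wedge_hom_def by blast
  have lin: "f (as @ (x + y) # bs) = f (as @ x # bs) + f (as @ y # bs) \<and>
      f (as @ sV c x # bs) = sX c (f (as @ x # bs))" for as x y bs c
  proof (cases "Suc (length as + length bs) = k")
    case True
    then have "Vector_Spaces.linear sV sX (\<lambda>x. f ((as @ 0 # bs)[length as := x]))"
      by (intro slot) auto
    then show ?thesis by (simp add: Vector_Spaces.linear_iff)
  next
    case False
    then show ?thesis
      using len assms(2) by (simp add: module.scale_zero_right module_iff_vector_space)
  qed
  moreover have "f (as @ x # x # bs) = 0" for as x bs
  proof (cases "Suc (Suc (length as + length bs)) = k")
    case True
    then show ?thesis by (intro alt[of _ "length as" "Suc (length as)"]) (auto simp: nth_append)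
  qed (use len in auto)
  ultimately show "alt_form sV sX f" by (auto simp: alt_form_def)
next
  assume *: "alt_form sV sX f \<and> (\<forall>xs. length xs \<noteq> k \<longrightarrow> f xs = 0)"
  then have f: "alt_form sV sX f" by simp
  have "Vector_Spaces.linear sV sX (\<lambda>x. f (xs[i := x]))" if "i < length xs" for xs i
    using f that assms by (simp add: upd_conv_take_nth_drop Vector_Spaces.linear_iff alt_form_def)
  moreover have "f xs = 0" if "i < j" "j < length xs" "xs ! i = xs ! j" for xs i j
  proof -
    have "xs = take i xs @ xs ! i # take (j - Suc i) (drop (Suc i) xs) @ xs ! j # drop (Suc j) xs"
      using that id_take_nth_drop[of i xs] id_take_nth_drop[of "j - Suc i" "drop (Suc i) xs"] by auto
    then show ?thesis using alt_form_eq_0[OF f] that(3) by metis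
  qed
  ultimately show "f \<in> wedge_hom sV sX k" using * unfolding wedge_hom_def by auto
qed

section \<open>Insertion of one alternating map into another, and its associator\<close>

definition insertion :: "nat \<Rightarrow> ('v list \<Rightarrow> 'v) \<Rightarrow> ('v list \<Rightarrow> 'v) \<Rightarrow> 'v list \<Rightarrow> 'v::ab_group_add" where
  "insertion k f g xs = unshuffle_sum k xs (\<lambda>as bs. f (g as # bs))"

lemma alt_form_insertion:
  assumes "vector_space s" "alt_form s s f" "alt_form s s g"
  shows "alt_form s s (insertion k f g)"
proof -
  have "alt_form s s (\<lambda>as. f (g as # bs))" for bs
    using alt_form_hd[OF assms(2)] alt_form_zero_hd[OF assms(2)] assms(3) unfolding alt_form_def by simp
  moreover have "alt_form s s (\<lambda>bs. f (g as # bs))" for as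
    by (rule alt_form_Cons[OF assms(2)])
  ultimately have "alt_form s s (\<lambda>xs. unshuffle_sum k xs (\<lambda>as bs. f (g as # bs)))"
    by (intro alt_form_unshuffle_sum assms(1))
  then show ?thesis unfolding insertion_def[abs_def] .
qed

lemma insertion_length:
  assumes "\<And>xs. length xs \<noteq> Suc p \<Longrightarrow> f xs = 0" "length xs \<noteq> k + p"
  shows "insertion k f g xs = 0"
  unfolding insertion_def by (rule unshuffle_sum_eq_0) (use assms(2) in \<open>auto intro!: assms(1)\<close>)

lemma wedge_hom_insertion:
  assumes "vector_space s" "f \<in> wedge_hom s s (Suc p)" "g \<in> wedge_hom s s (Suc q)"
  shows "insertion (Suc q) f g \<in> wedge_hom s s (Suc (p + q))"
  using assms alt_form_insertion[OF assms(1), of f g] insertion_length[of p f]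
  by (simp add: wedge_hom_iff)

lemma insertion_minus_left:
  "insertion k (\<lambda>xs. f xs - signed n (f' xs)) g xs =
    insertion k f g xs - signed n (insertion k f' g xs)"
  by (simp add: insertion_def unshuffle_sum_diff unshuffle_sum_signed)

lemma insertion_minus_right:
  assumes "alt_form sV sX f"
  shows "insertion k f (\<lambda>xs. g xs - signed n (g' xs)) xs =
    insertion k f g xs - signed n (insertion k f g' xs)"
proof -
  note a = additive_alt_form_hd[OF assms]
  have "f ((u - signed n v) # bs) = f (u # bs) - signed n (f (v # bs))" for u v bs
    using additive.diff[OF a] additive.minus[OF a] by (simp add: signed_def)
  then show ?thesis by (simp add: insertion_def unshuffle_sum_diff unshuffle_sum_signed)
qed

text \<open>Once \<open>h\<close> has been evaluated, its value is the head of the list that is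
  split for \<open>g\<close>. Either it becomes an argument of \<open>g\<close>, or it passes the
  \<open>Suc q\<close> arguments of \<open>g\<close> and lands in a slot of \<open>f\<close> of its
  own.\<close>

lemma insertion_insertion:
  assumes "alt_form s s f"
  shows "insertion (Suc r) (insertion (Suc q) f g) h xs =
    insertion (Suc (q + r)) f (insertion (Suc r) g h) xs +
    signed (Suc q) (unshuffle_sum (Suc r) xs
      (\<lambda>as bs. unshuffle_sum (Suc q) bs (\<lambda>cs ds. f (g cs # h as # ds))))"
proof -
  \<comment> \<open>Coassociativity joins the arguments of \<open>h\<close> and the remaining
    arguments of \<open>g\<close> into one block.\<close>
  have "unshuffle_sum (Suc r) xs (\<lambda>as bs. unshuffle_sum q bs (\<lambda>cs ds. f (g (h as # cs) # ds))) =
      insertion (Suc (q + r)) f (insertion (Suc r) g h) xs"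
    unfolding unshuffle_sum_coassoc insertion_def
    by (simp add: unshuffle_sum_additive[OF additive_alt_form_hd[OF assms]] add.commute)
  then show ?thesis
    unfolding insertion_def[of "Suc r" "insertion (Suc q) f g"]
    by (simp add: insertion_def[of _ f g] unshuffle_sum_add unshuffle_sum_signed)
qed

text \<open>By \<open>insertion_insertion\<close> the associator is the term with \<open>g\<close>
  and \<open>h\<close> in separate slots of \<open>f\<close>. Exchanging them costs -1 from the
  alternation of \<open>f\<close> and \<open>(q + 1) * (r + 1)\<close> transpositions of their
  arguments.\<close>

lemma insertion_pre_Lie:
  assumes "alt_form s s f"
  shows "insertion (Suc r) (insertion (Suc q) f g) h xs -
      insertion (Suc (q + r)) f (insertion (Suc r) g h) xs =
    signed (q * r) (insertion (Suc q) (insertion (Suc r) f h) g xs -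
      insertion (Suc (q + r)) f (insertion (Suc q) h g) xs)"
proof -
  let ?T = "\<lambda>cs as ds. f (g cs # h as # ds)"
  have "unshuffle_sum (Suc q) xs (\<lambda>cs bs. unshuffle_sum (Suc r) bs (\<lambda>as ds. f (h as # g cs # ds))) =
      - unshuffle_sum (Suc q) xs (\<lambda>cs bs. unshuffle_sum (Suc r) bs (\<lambda>as ds. ?T cs as ds))"
  proof -
    have "f (h as # g cs # ds) = - ?T cs as ds" for as cs ds
      using alt_form_swap[OF assms, of "[]" "h as" "g cs"] by simp
    then show ?thesis by (simp add: unshuffle_sum_uminus)
  qed
  also have "\<dots> = - unshuffle_sum (Suc q + Suc r) xs (\<lambda>es ds. unshuffle_sum (Suc q) es (\<lambda>cs as. ?T cs as ds))"
    unfolding unshuffle_sum_coassoc ..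
  \<comment> \<open>The congruence supplies \<open>length es = Suc q + Suc r\<close>, which the
    exchange of the two blocks requires.\<close>
  also have "\<dots> = - unshuffle_sum (Suc q + Suc r) xs
      (\<lambda>es ds. signed (Suc q * Suc r) (unshuffle_sum (Suc r) es (\<lambda>as cs. ?T cs as ds)))"
    by (rule arg_cong[of _ _ uminus], rule unshuffle_sum_cong, rule unshuffle_sum_swap) simp
  also have "\<dots> = - signed (Suc q * Suc r)
      (unshuffle_sum (Suc r) xs (\<lambda>as bs. unshuffle_sum (Suc q) bs (\<lambda>cs ds. ?T cs as ds)))"
    unfolding unshuffle_sum_coassoc unshuffle_sum_signed by (simp only: add.commute)
  finally show ?thesis
    using insertion_insertion[OF assms, of r q g h xs] insertion_insertion[OF assms, of q r h g xs]
    by (simp add: add.commute[of r q] signed_def)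
qed

section \<open>The graded commutator of insertions and its Jacobi identity\<close>

definition NR_comm :: "nat \<Rightarrow> nat \<Rightarrow> ('v list \<Rightarrow> 'v) \<Rightarrow> ('v list \<Rightarrow> 'v) \<Rightarrow> 'v list \<Rightarrow> 'v::ab_group_add" where
  "NR_comm p q f g = (\<lambda>xs. insertion (Suc q) f g xs - signed (p * q) (insertion (Suc p) g f xs))"

text \<open>The sign bookkeeping for the graded Jacobi identity of a pre-Lie product. The letters a,
  b, c stand for right-nested composites with outermost map f, g, h, and u, v, w for (f h) g, (g h)
  f, (h g) f. Only the parities of the degrees matter.\<close>

lemma signed_Jacobi:
  fixes a1 :: "'a::ab_group_add"
  shows "a1 - signed (q * r) a2 - signed (p * (q + r)) (v - signed (q * r) w) =
    a1 + signed (q * r) (u - a2) - signed (p * q) (b1 + signed (p * r) (v - b2)) -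
      signed ((p + q) * r) (c1 - signed (p * q) c2) +
    signed (p * q) (b1 - signed (p * r) b2 - signed (q * (p + r))
      (u - signed (p * r) (c1 + signed (p * q) (w - c2))))"
proof (cases "even p"; cases "even q"; cases "even r")
qed (simp_all only: signed_def even_mult_iff even_add simp_thms if_True if_False, simp_all)

lemma NR_comm_Jacobi:
  assumes "alt_form s s f" "alt_form s s g" "alt_form s s h"
  shows "NR_comm p (q + r) f (NR_comm q r g h) xs =
    NR_comm (p + q) r (NR_comm p q f g) h xs + signed (p * q) (NR_comm q (p + r) g (NR_comm p r f h) xs)"
proof -
  \<comment> \<open>Three of the six left-nested composites are expressed through the other three,
    so the rewriting does not return to its start.\<close>
  have P: "insertion (Suc r) (insertion (Suc q) f g) h xs =
      insertion (Suc (q + r)) f (insertion (Suc r) g h) xs +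
      signed (q * r) (insertion (Suc q) (insertion (Suc r) f h) g xs -
        insertion (Suc (q + r)) f (insertion (Suc q) h g) xs)"
    "insertion (Suc r) (insertion (Suc p) g f) h xs =
      insertion (Suc (p + r)) g (insertion (Suc r) f h) xs +
      signed (p * r) (insertion (Suc p) (insertion (Suc r) g h) f xs -
        insertion (Suc (p + r)) g (insertion (Suc p) h f) xs)"
    "insertion (Suc q) (insertion (Suc p) h f) g xs =
      insertion (Suc (p + q)) h (insertion (Suc q) f g) xs +
      signed (p * q) (insertion (Suc p) (insertion (Suc q) h g) f xs -
        insertion (Suc (p + q)) h (insertion (Suc p) g f) xs)"
    using insertion_pre_Lie[OF assms(1), of r q g h xs] insertion_pre_Lie[OF assms(2), of r p f h xs]
      insertion_pre_Lie[OF assms(3), of q p f g xs]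
    by (simp_all add: algebra_simps)
  show ?thesis
    unfolding NR_comm_def insertion_minus_left insertion_minus_right[OF assms(1)]
      insertion_minus_right[OF assms(2)] insertion_minus_right[OF assms(3)] P
    by (rule signed_Jacobi)
qed

lemma NR_comm_antisym: "NR_comm p q f g xs = - signed (p * q) (NR_comm q p g f xs)"
  by (simp add: NR_comm_def signed_def mult.commute)

lemma wedge_hom_subspace:
  assumes "vector_space sV" "vector_space sX"
  shows "0 \<in> wedge_hom sV sX k"
    "f \<in> wedge_hom sV sX k \<Longrightarrow> g \<in> wedge_hom sV sX k \<Longrightarrow> f + g \<in> wedge_hom sV sX k"
    "f \<in> wedge_hom sV sX k \<Longrightarrow> Hom_scale sX c f \<in> wedge_hom sV sX k"
proof -
  interpret vector_space sX by fact
  show "0 \<in> wedge_hom sV sX k"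
    using assms by (simp add: wedge_hom_iff zero_fun_def alt_form_0)
  show "f \<in> wedge_hom sV sX k \<Longrightarrow> g \<in> wedge_hom sV sX k \<Longrightarrow> f + g \<in> wedge_hom sV sX k"
    using assms by (simp add: wedge_hom_iff plus_fun_def alt_form_plus)
  show "f \<in> wedge_hom sV sX k \<Longrightarrow> Hom_scale sX c f \<in> wedge_hom sV sX k"
    using assms by (simp add: wedge_hom_iff Hom_scale_def alt_form_scaled)
qed

lemma wedge_hom_NR_comm:
  assumes "vector_space s" "f \<in> wedge_hom s s (Suc p)" "g \<in> wedge_hom s s (Suc q)"
  shows "NR_comm p q f g \<in> wedge_hom s s (Suc (p + q))"
  using wedge_hom_insertion[OF assms] wedge_hom_insertion[OF assms(1,3,2)] assms(1)
  by (simp add: NR_comm_def wedge_hom_iff alt_form_minus alt_form_signed add.commute)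
   (simp add: signed_def)

section \<open>Comparison with the bracket defined by shuffles\<close>

lemma NR_circ_eq:
  assumes "vector_space s"
  shows "NR_circ s p q f g xs = (if length xs = p + q + 1 then insertion (Suc q) f g xs else 0)"
proof -
  show ?thesis
    using sum_Sh[of xs "Suc q" p "\<lambda>as bs. f (g as # bs)"]
    by (simp add: NR_circ_def insertion_def scale_sign[OF assms] add.commute del: upt_Suc)
qed

lemma NR_bracket_eq:
  assumes "vector_space s"
  shows "NR_bracket s f g xs = (\<Sum>(p, q) | p + q + 1 = length xs. NR_comm p q f g xs)"
proof -
  interpret vector_space s by fact
  have "s ((- 1) ^ n) v = signed n v" for n v by (simp add: signed_def minus_one_power_iff)
  then show ?thesis
    unfolding NR_bracket_def by (intro sum.cong) (auto simp: NR_circ_eq[OF assms] NR_comm_def)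
qed

lemma NR_bracket_wedge_hom:
  assumes "vector_space s" "f \<in> wedge_hom s s (Suc p)" "g \<in> wedge_hom s s (Suc q)"
  shows "NR_bracket s f g = NR_comm p q f g"
proof
  fix xs
  have f: "alt_form s s f" "\<And>xs. length xs \<noteq> Suc p \<Longrightarrow> f xs = 0"
    and g: "alt_form s s g" "\<And>xs. length xs \<noteq> Suc q \<Longrightarrow> g xs = 0"
    using assms by (simp_all add: wedge_hom_iff)
  \<comment> \<open>With the wrong degrees, either the inner map receives a block of the wrong
    length, so that the outer one sees 0 in its first slot, or the outer map receives a list of the
    wrong length.\<close>
  have z: "insertion (Suc q') f g xs = 0" "insertion (Suc p') g f xs = 0"
    if "p' + q' + 1 = length xs" "(p', q') \<noteq> (p, q)" for p' q'
    using that f g alt_form_zero_hd[OF f(1)] alt_form_zero_hd[OF g(1)]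
    unfolding insertion_def by (auto intro!: unshuffle_sum_eq_0)
  then have z: "NR_comm p' q' f g xs = 0" if "p' + q' + 1 = length xs" "(p', q') \<noteq> (p, q)" for p' q'
    using that by (simp add: NR_comm_def signed_def)
  let ?S = "{(p', q'). p' + q' + 1 = length xs}"
  have fin: "finite ?S" by (rule finite_subset[of _ "{..length xs} \<times> {..length xs}"]) auto
  have "NR_bracket s f g xs = (\<Sum>(p', q')\<in>?S \<inter> {(p, q)}. NR_comm p' q' f g xs)"
    unfolding NR_bracket_eq[OF assms(1)]
    by (rule sum.mono_neutral_right[OF fin]) (use z in auto)
  \<comment> \<open>If the length of \<open>xs\<close> is not \<open>p + q + 1\<close>, the sum is
    empty and the right-hand side vanishes by its arity.\<close>
  also have "\<dots> = NR_comm p q f g xs"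
    using wedge_hom_NR_comm[OF assms] by (cases "(p, q) \<in> ?S") (auto simp: wedge_hom_def)
  finally show "NR_bracket s f g xs = NR_comm p q f g xs" .
qed

section \<open>Graded Lie algebras of alternating maps\<close>

lemma vector_space_Hom_scale:
  assumes "vector_space sX"
  shows "vector_space (Hom_scale sX)"
proof -
  interpret vector_space sX by fact
  show ?thesis by standard (simp_all add: Hom_scale_def fun_eq_iff algebra_simps)
qed

lemma subspace_iff:
  "vector_space sc \<Longrightarrow> module.subspace sc S \<longleftrightarrow>
    0 \<in> S \<and> (\<forall>x\<in>S. \<forall>y\<in>S. x + y \<in> S) \<and> (\<forall>c. \<forall>x\<in>S. sc c x \<in> S)"
  by (simp add: module.subspace_def module_iff_vector_space)

lemma Hom_comp_of_nat [simp]: "Hom_comp sV sX (int n) = wedge_hom sV sX (Suc n)"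
  by (simp add: Hom_comp_def)

lemma Hom_comp_cases:
  assumes "f \<in> Hom_comp sV sX n"
  obtains "n < 0" "f = 0" | m where "n = int m" "f \<in> wedge_hom sV sX (Suc m)"
  using assms by (cases n rule: int_cases3) (auto simp: Hom_comp_def split: if_splits)

lemma subspace_Hom_comp:
  assumes "vector_space sV" "vector_space sX"
  shows "module.subspace (Hom_scale sX) (Hom_comp sV sX n)"
proof -
  interpret vector_space sX by fact
  show ?thesis
    using wedge_hom_subspace[OF assms]
    by (auto simp: subspace_iff[OF vector_space_Hom_scale[OF assms(2)]] Hom_comp_def)
     (auto simp: Hom_scale_def zero_fun_def)
qed

lemma Hom_comp_alt_form:
  assumes "vector_space sV" "vector_space sX" "f \<in> Hom_comp sV sX n"
  shows "alt_form sV sX f"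
  using assms(3)
  by (cases rule: Hom_comp_cases)
    (use assms(1,2) in \<open>auto simp: wedge_hom_iff alt_form_0 zero_fun_def\<close>)

lemma Hom_comp_length:
  assumes "f \<in> Hom_comp sV sX n" "n < 0 \<or> int (length xs) \<noteq> n + 1"
  shows "f xs = 0"
  using assms(1) by (cases rule: Hom_comp_cases) (use assms(2) in \<open>auto simp: wedge_hom_def\<close>)

lemma Hom_compI:
  assumes "vector_space sV" "vector_space sX" "alt_form sV sX f"
    "\<And>xs. n < 0 \<or> int (length xs) \<noteq> n + 1 \<Longrightarrow> f xs = 0"
  shows "f \<in> Hom_comp sV sX n"
proof (cases "n < 0")
  case True
  then have "f xs = 0" for xs by (intro assms(4)) simp
  then have "f = 0" by (simp add: fun_eq_iff)
  then show ?thesis using True by (simp add: Hom_comp_def)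
next
  case False
  then show ?thesis using assms(3,4) by (simp add: Hom_comp_def wedge_hom_iff[OF assms(1,2)])
qed

text \<open>Elements of the total space may mix degrees. Being alternating is a linear condition
  shared by all components, hence it passes to their span.\<close>

lemma gtotal_alt_form:
  assumes "vector_space sV" "vector_space sX" "gscale V = Hom_scale sX"
    "\<And>n. gcomp V n \<subseteq> Hom_comp sV sX n" "f \<in> gtotal V"
  shows "alt_form sV sX f"
proof -
  have vs: "vector_space (Hom_scale sX)" by (rule vector_space_Hom_scale[OF assms(2)])
  have "module.subspace (Hom_scale sX) (Collect (alt_form sV sX))"
    using assms(1,2) by (simp add: subspace_iff[OF vs] alt_form_0 alt_form_plus alt_form_scaled
        Hom_scale_def zero_fun_def plus_fun_def)
  moreover have "(\<Union>n. gcomp V n) \<subseteq> Collect (alt_form sV sX)"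
    using assms(1,2,4) Hom_comp_alt_form by blast
  ultimately have "gtotal V \<subseteq> Collect (alt_form sV sX)"
    unfolding gtotal_def assms(3) using vs by (intro module.span_minimal) (auto simp: module_iff_vector_space)
  then show ?thesis using assms(5) by blast
qed

lemma sum_fun_apply: "(\<Sum>i\<in>I. f i) x = (\<Sum>i\<in>I. f i x)"
  by (induction I rule: infinite_finite_induct) auto

text \<open>Different degrees live on lists of different lengths, so evaluation at a list of length
  \<open>n + 1\<close> isolates the component of degree \<open>n\<close>.\<close>

lemma graded_vector_space_Hom:
  assumes "vector_space sV" "vector_space sX" "gscale V = Hom_scale sX"
    "\<And>n. gcomp V n \<subseteq> Hom_comp sV sX n" "\<And>n. module.subspace (Hom_scale sX) (gcomp V n)"
  shows "graded_vector_space V"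
proof -
  have "x n = 0" if x: "finite N" "\<forall>n\<in>N. x n \<in> gcomp V n" "(\<Sum>n\<in>N. x n) = 0" "n \<in> N" for N x n
  proof
    fix xs
    have c: "x m xs = 0" if "m \<in> N" "int (length xs) \<noteq> m + 1" for m
      using x(2) that assms(4) Hom_comp_length by blast
    show "x n xs = 0 xs"
    proof (cases "int (length xs) = n + 1")
      case True
      have "0 = (\<Sum>m\<in>N. x m) xs" using x(3) by simp
      also have "\<dots> = (\<Sum>m\<in>N. x m xs)" by (rule sum_fun_apply)
      also have "\<dots> = (\<Sum>m\<in>{n}. x m xs)"
        by (rule sum.mono_neutral_right) (use x c True in auto)
      finally show ?thesis by simp
    qed (use c x(4) in simp)
  qed
  then show ?thesis
    unfolding graded_vector_space_def assms(3)
    using vector_space_Hom_scale[OF assms(2)] assms(5) by blast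
qed

section \<open>Bilinearity, grading and Jacobi identity of the bracket\<close>

lemma insertion_add_left: "insertion k (f + f') g xs = insertion k f g xs + insertion k f' g xs"
  by (simp add: insertion_def unshuffle_sum_add)

lemma insertion_add_right:
  assumes "alt_form s s g"
  shows "insertion k g (f + f') xs = insertion k g f xs + insertion k g f' xs"
  by (simp add: insertion_def unshuffle_sum_add alt_form_hd[OF assms])

lemma insertion_scale:
  assumes "vector_space s"
  shows "insertion k (Hom_scale s c f) g xs = s c (insertion k f g xs)"
    and "alt_form s s f \<Longrightarrow> insertion k f (Hom_scale s c g) xs = s c (insertion k f g xs)"
proof -
  interpret vector_space s by fact
  have a: "Modules.additive (s c)" by (simp add: additive.intro algebra_simps)
  show "insertion k (Hom_scale s c f) g xs = s c (insertion k f g xs)"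
    by (simp add: insertion_def Hom_scale_def unshuffle_sum_additive[OF a])
  show "alt_form s s f \<Longrightarrow> insertion k f (Hom_scale s c g) xs = s c (insertion k f g xs)"
    by (simp add: insertion_def Hom_scale_def unshuffle_sum_additive[OF a] alt_form_hd)
qed

lemma NR_comm_add:
  assumes "alt_form s s g"
  shows "NR_comm p q (f + f') g xs = NR_comm p q f g xs + NR_comm p q f' g xs"
    and "NR_comm p q g (f + f') xs = NR_comm p q g f xs + NR_comm p q g f' xs"
  by (simp_all add: NR_comm_def insertion_add_left insertion_add_right[OF assms] signed_add)

lemma NR_comm_scale:
  assumes "vector_space s" "alt_form s s g"
  shows "NR_comm p q (Hom_scale s c f) g xs = s c (NR_comm p q f g xs)"
    and "NR_comm p q g (Hom_scale s c f) xs = s c (NR_comm p q g f xs)"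
proof -
  interpret vector_space s by fact
  show "NR_comm p q (Hom_scale s c f) g xs = s c (NR_comm p q f g xs)"
    "NR_comm p q g (Hom_scale s c f) xs = s c (NR_comm p q g f xs)"
    using assms by (simp_all add: NR_comm_def insertion_scale signed_def scale_right_diff_distrib
        scale_right_distrib)
qed

lemma NR_bracket_add:
  assumes "vector_space s" "alt_form s s g"
  shows "NR_bracket s (f + f') g = NR_bracket s f g + NR_bracket s f' g"
    and "NR_bracket s g (f + f') = NR_bracket s g f + NR_bracket s g f'"
  by (simp_all add: fun_eq_iff NR_bracket_eq[OF assms(1)] NR_comm_add[OF assms(2)] sum.distrib
      case_prod_unfold)

lemma NR_bracket_scale:
  assumes "vector_space s" "alt_form s s g"
  shows "NR_bracket s (Hom_scale s c f) g = Hom_scale s c (NR_bracket s f g)"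
    and "NR_bracket s g (Hom_scale s c f) = Hom_scale s c (NR_bracket s g f)"
proof -
  interpret vector_space s by fact
  show "NR_bracket s (Hom_scale s c f) g = Hom_scale s c (NR_bracket s f g)"
    "NR_bracket s g (Hom_scale s c f) = Hom_scale s c (NR_bracket s g f)"
    by (simp_all add: fun_eq_iff NR_bracket_eq[OF assms(1)] NR_comm_scale[OF assms]
        scale_sum_right case_prod_unfold Hom_scale_def[of s c "NR_bracket s _ _"])
qed

lemma NR_bracket_0:
  assumes "vector_space s" "alt_form s s g"
  shows "NR_bracket s 0 g = 0" "NR_bracket s g 0 = 0"
  using NR_bracket_add[OF assms, of 0 0] by simp_all

lemma Hom_scale_sign:
  assumes "vector_space s"
  shows "Hom_scale s ((- 1) powi (int m * int n)) f = (\<lambda>xs. signed (m * n) (f xs))"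
proof -
  interpret vector_space s by fact
  show ?thesis
    unfolding of_nat_mult[symmetric] power_int_of_nat
    by (simp add: Hom_scale_def signed_def minus_one_power_iff fun_eq_iff)
qed

lemma NR_bracket_Hom_comp:
  assumes "vector_space s" "f \<in> Hom_comp s s p" "g \<in> Hom_comp s s q"
  shows "NR_bracket s f g \<in> Hom_comp s s (p + q)"
proof -
  note alt = assms(2,3)[THEN Hom_comp_alt_form[OF assms(1,1)]]
  have zero: "0 \<in> Hom_comp s s n" for n
    using subspace_Hom_comp[OF assms(1,1)] by (simp add: subspace_iff vector_space_Hom_scale assms(1))
  show ?thesis
    using assms(2)
  proof (cases rule: Hom_comp_cases)
    case 1
    then show ?thesis using NR_bracket_0[OF assms(1) alt(2)] zero by simp
  next
    case (2 m)
    note f = this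
    show ?thesis
      using assms(3)
    proof (cases rule: Hom_comp_cases)
      case 1
      then show ?thesis using NR_bracket_0[OF assms(1) alt(1)] zero by simp
    next
      case (2 n)
      then show ?thesis
        using f NR_bracket_wedge_hom[OF assms(1) f(2) 2(2)] wedge_hom_NR_comm[OF assms(1) f(2) 2(2)]
        by (simp flip: of_nat_add)
    qed
  qed
qed

lemma NR_bracket_antisym:
  assumes "vector_space s" "f \<in> Hom_comp s s p" "g \<in> Hom_comp s s q"
  shows "NR_bracket s f g = - Hom_scale s ((- 1) powi (p * q)) (NR_bracket s g f)"
proof -
  interpret vector_space s by fact
  note alt = assms(2,3)[THEN Hom_comp_alt_form[OF assms(1,1)]]
  have H: "Hom_scale s c 0 = 0" for c by (simp add: Hom_scale_def fun_eq_iff)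
  show ?thesis
    using assms(2)
  proof (cases rule: Hom_comp_cases)
    case 1
    then show ?thesis using NR_bracket_0[OF assms(1) alt(2)] H by simp
  next
    case (2 m)
    note f = this
    show ?thesis
      using assms(3)
    proof (cases rule: Hom_comp_cases)
      case 1
      then show ?thesis using NR_bracket_0[OF assms(1) alt(1)] H by simp
    next
      case (2 n)
      have "NR_comm m n f g = - (\<lambda>xs. signed (m * n) (NR_comm n m g f xs))"
        using NR_comm_antisym by (auto simp: fun_eq_iff)
      then show ?thesis
        unfolding f(1) 2(1) Hom_scale_sign[OF assms(1)] NR_bracket_wedge_hom[OF assms(1) f(2) 2(2)]
          NR_bracket_wedge_hom[OF assms(1) 2(2) f(2)] .
    qed
  qed
qed

lemma NR_bracket_Jacobi:
  assumes "vector_space s" "f \<in> Hom_comp s s p" "g \<in> Hom_comp s s q" "h \<in> Hom_comp s s r"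
  shows "NR_bracket s f (NR_bracket s g h) = NR_bracket s (NR_bracket s f g) h +
    Hom_scale s ((- 1) powi (p * q)) (NR_bracket s g (NR_bracket s f h))"
proof -
  interpret vector_space s by fact
  note alt = assms(2-4)[THEN Hom_comp_alt_form[OF assms(1,1)]]
  have br: "alt_form s s (NR_bracket s f g)" "alt_form s s (NR_bracket s g h)"
      "alt_form s s (NR_bracket s f h)"
    using NR_bracket_Hom_comp[OF assms(1)] Hom_comp_alt_form[OF assms(1,1)] assms(2-4) by blast+
  have H: "Hom_scale s c 0 = 0" for c by (simp add: Hom_scale_def fun_eq_iff)
  show ?thesis
  \<comment> \<open>Negative degrees contain only 0, so outside this case all three degrees are
    natural numbers.\<close>
  proof (cases "f = 0 \<or> g = 0 \<or> h = 0")
    case True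
    then show ?thesis by (auto simp: NR_bracket_0[OF assms(1)] alt br H)
  next
    case False
    obtain m where f: "p = int m" "f \<in> wedge_hom s s (Suc m)"
      using assms(2) False by (elim Hom_comp_cases) auto
    obtain n where g: "q = int n" "g \<in> wedge_hom s s (Suc n)"
      using assms(3) False by (elim Hom_comp_cases) auto
    obtain k where h: "r = int k" "h \<in> wedge_hom s s (Suc k)"
      using assms(4) False by (elim Hom_comp_cases) auto
    note fg = wedge_hom_NR_comm[OF assms(1) f(2) g(2)]
    note gh = wedge_hom_NR_comm[OF assms(1) g(2) h(2)]
    note fh = wedge_hom_NR_comm[OF assms(1) f(2) h(2)]
    note eq = NR_bracket_wedge_hom[OF assms(1)]
    show ?thesis
      unfolding f(1) g(1) Hom_scale_sign[OF assms(1)] eq[OF f(2) g(2)] eq[OF g(2) h(2)]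
        eq[OF f(2) h(2)] eq[OF fg h(2)] eq[OF f(2) gh] eq[OF g(2) fh]
      by (rule ext) (simp add: NR_comm_Jacobi[OF alt])
  qed
qed

lemma graded_Lie_NR_algebra:
  assumes "vector_space s"
  shows "graded_Lie_algebra (NR_algebra s)"
proof -
  have tot: "alt_form s s f" if "f \<in> gtotal (NR_algebra s)" for f
    using gtotal_alt_form[OF assms assms _ _ that] by (simp add: NR_algebra_def)
  have "graded_vector_space (NR_algebra s)"
    using assms by (intro graded_vector_space_Hom[of s s])
      (simp_all add: NR_algebra_def subspace_Hom_comp)
  moreover have sel: "gbr (NR_algebra s) = NR_bracket s" "gcomp (NR_algebra s) = Hom_comp s s"
    "gscale (NR_algebra s) = Hom_scale s"
    by (simp_all add: NR_algebra_def)
  ultimately show ?thesis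
    unfolding graded_Lie_algebra_def sel
    by (intro conjI ballI allI)
      (assumption | rule NR_bracket_add NR_bracket_scale NR_bracket_Hom_comp NR_bracket_antisym
        NR_bracket_Jacobi assms tot)+
qed

lemma abelian_graded_Lie_Hom:
  assumes "vector_space sV" "vector_space sX"
  shows "abelian_graded_Lie_algebra (abelian_Hom sV sX)"
proof -
  interpret module "Hom_scale sX"
    using vector_space_Hom_scale[OF assms(2)] by (simp add: module_iff_vector_space)
  have "graded_vector_space (abelian_Hom sV sX)"
    using assms by (intro graded_vector_space_Hom[of sV sX])
      (simp_all add: abelian_Hom_def subspace_Hom_comp)
  then show ?thesis
    using subspace_0[OF subspace_Hom_comp[OF assms]]
    unfolding abelian_graded_Lie_algebra_def graded_Lie_algebra_def
    by (simp add: abelian_Hom_def zero_fun_def[symmetric])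
qed

text \<open>The axioms restrict because the total space of \<open>K\<close> lies in that of
  \<open>L\<close>. This makes M' a graded Lie algebra inside L'.\<close>

lemma graded_Lie_algebra_subalgebra:
  assumes "graded_Lie_algebra L" "graded_Lie_subalgebra L K"
  shows "graded_Lie_algebra (L\<lparr>gcomp := K\<rparr>)"
proof -
  have m: "module (gscale L)"
    using assms(1) by (simp add: graded_Lie_algebra_def graded_vector_space_def module_iff_vector_space)
  have K: "K n \<subseteq> gcomp L n" for n using assms(2) by (simp add: graded_Lie_subalgebra_def)
  have sel: "gscale (L\<lparr>gcomp := K\<rparr>) = gscale L" "gcomp (L\<lparr>gcomp := K\<rparr>) = K"
    "gbr (L\<lparr>gcomp := K\<rparr>) = gbr L"
    by simp_all
  have tot: "x \<in> gtotal (L\<lparr>gcomp := K\<rparr>) \<Longrightarrow> x \<in> gtotal L" for x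
    using K module.span_mono[OF m, of "\<Union>n. K n" "\<Union>n. gcomp L n"] unfolding gtotal_def sel by blast
  have "graded_vector_space (L\<lparr>gcomp := K\<rparr>)"
    using assms K unfolding graded_Lie_algebra_def graded_vector_space_def graded_Lie_subalgebra_def sel
    by (intro conjI) (blast | meson subsetD)+
  then show ?thesis
    using assms K tot unfolding graded_Lie_algebra_def graded_Lie_subalgebra_def sel
    by (intro conjI) (blast | meson subsetD)+
qed

section \<open>The embeddings of the absolute datum in product coordinates\<close>

text \<open>Unshuffling, insertion and sums all commute with \<phi>. The lemma is applied to
  \<open>fst\<close>, to the sum of both coordinates and to the inclusion of the first
  factor.\<close>

lemma NR_bracket_intertwine:
  assumes "vector_space s" "vector_space t" "Modules.additive \<phi>"
    "\<And>zs. \<phi> (F zs) = f (map \<phi> zs)" "\<And>zs. \<phi> (G zs) = g (map \<phi> zs)"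
  shows "\<phi> (NR_bracket s F G zs) = NR_bracket t f g (map \<phi> zs)"
proof -
  note add = additive.sum[OF assms(3)] additive.diff[OF assms(3)] additive.minus[OF assms(3)]
  have "\<phi> (insertion k F' G' zs) = insertion k f' g' (map \<phi> zs)"
    if "\<And>zs. \<phi> (F' zs) = f' (map \<phi> zs)" "\<And>zs. \<phi> (G' zs) = g' (map \<phi> zs)" for k F' G' f' g'
    by (simp add: insertion_def unshuffle_sum_additive[OF assms(3)] unshuffle_sum_map that)
  then have "\<phi> (NR_comm p q F G zs) = NR_comm p q f g (map \<phi> zs)" for p q
    using assms(4,5) by (simp add: NR_comm_def signed_def add)
  then show ?thesis
    by (simp add: NR_bracket_eq[OF assms(1)] NR_bracket_eq[OF assms(2)] add case_prod_unfold)
qed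

text \<open>Multilinear expansion: each entry contributes \<alpha> or \<beta>, and collecting the
  \<alpha>-entries in front produces the sign of the unshuffle.\<close>

lemma alt_form_map_add:
  assumes "alt_form sV sX f"
  shows "f (map (\<lambda>z. \<alpha> z + \<beta> z) zs) =
    (\<Sum>k\<le>length zs. unshuffle_sum k zs (\<lambda>as bs. f (map \<alpha> as @ map \<beta> bs)))"
  using assms
proof (induction zs arbitrary: f)
  case (Cons z zs)
  let ?H = "\<lambda>as bs. f (map \<alpha> as @ map \<beta> bs)"
  have "f (map (\<lambda>z. \<alpha> z + \<beta> z) (z # zs)) =
      f (\<alpha> z # map (\<lambda>z. \<alpha> z + \<beta> z) zs) + f (\<beta> z # map (\<lambda>z. \<alpha> z + \<beta> z) zs)"
    using alt_form_hd(1)[OF Cons.prems] by simp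
  also have "f (\<alpha> z # map (\<lambda>z. \<alpha> z + \<beta> z) zs) =
      (\<Sum>k\<le>length zs. unshuffle_sum k zs (\<lambda>as. ?H (z # as)))"
    using Cons.IH[OF alt_form_Cons[OF Cons.prems, of "\<alpha> z"]] by simp
  also have "f (\<beta> z # map (\<lambda>z. \<alpha> z + \<beta> z) zs) =
      (\<Sum>k\<le>length zs. unshuffle_sum k zs (\<lambda>as bs. f (\<beta> z # map \<alpha> as @ map \<beta> bs)))"
    using Cons.IH[OF alt_form_Cons[OF Cons.prems, of "\<beta> z"]] by simp
  \<comment> \<open>Here \<open>\<beta> z\<close> is moved past the \<open>k\<close> entries of the
    first block.\<close>
  also have "\<dots> = (\<Sum>k\<le>length zs. signed k (unshuffle_sum k zs (\<lambda>as bs. ?H as (z # bs))))"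
  proof (rule sum.cong[OF refl])
    fix k
    have "unshuffle_sum k zs (\<lambda>as bs. f (\<beta> z # map \<alpha> as @ map \<beta> bs)) =
        unshuffle_sum k zs (\<lambda>as bs. signed k (?H as (z # bs)))"
      by (rule unshuffle_sum_cong) (use alt_form_move[OF Cons.prems, of "[]" "\<beta> z"] in auto)
    then show "unshuffle_sum k zs (\<lambda>as bs. f (\<beta> z # map \<alpha> as @ map \<beta> bs)) =
        signed k (unshuffle_sum k zs (\<lambda>as bs. ?H as (z # bs)))"
      by (simp only: unshuffle_sum_signed)
  qed
  \<comment> \<open>The added term is 0, since \<open>zs\<close> is too short; the range now matches
    that of the sum for \<open>z # zs\<close>.\<close>
  also have "\<dots> = (\<Sum>k\<le>Suc (length zs). signed k (unshuffle_sum k zs (\<lambda>as bs. ?H as (z # bs))))"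
    by (simp add: unshuffle_sum_gt signed_def)
  finally show ?case
    by (simp only: length_Cons sum.atMost_Suc_shift unshuffle_sum.simps sum.distrib)
      (simp add: signed_def algebra_simps)
qed simp

lemma summand_ext_eq:
  assumes "vector_space sX"
  shows "summand_ext sX k l F zs =
    (if length zs = k + l then unshuffle_sum k zs (\<lambda>as bs. F (map fst as) (map snd bs)) else 0)"
proof -
  show ?thesis
    using sum_Sh[of zs k l "\<lambda>as bs. F (map fst as) (map snd bs)"]
    by (simp add: summand_ext_def scale_sign[OF assms] o_def)
qed

lemma summand_ext_left:
  "vector_space sX \<Longrightarrow>
    summand_ext sX k 0 F zs = (if length zs = k then F (map fst zs) [] else 0)"
  using unshuffle_sum_length[of zs "\<lambda>as bs. F (map fst as) (map snd bs)"]
  by (auto simp: summand_ext_eq)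

lemma sum_reverse_atLeast1: "(\<Sum>l = 1..n. T (n - l)) = (\<Sum>k<n. T k)" for n :: nat
  by (rule sum.reindex_bij_witness[of _ "\<lambda>k. n - k" "\<lambda>l. n - l"]) auto

text \<open>The sum over the f_i with i at least 1 is the full expansion of \<open>f\<close> at the
  sums of coordinates, except for the term with an empty second block. That term is
  \<open>f (map fst zs)\<close> and is subtracted.\<close>

lemma iota_M_eq:
  assumes "vector_space s" "alt_form s s f"
  shows "iota_M s f zs = (f (map fst zs), f (map (\<lambda>z. fst z + snd z) zs) - f (map fst zs))"
proof -
  let ?n = "length zs"
  let ?T = "\<lambda>k. unshuffle_sum k zs (\<lambda>as bs. f (map fst as @ map snd bs))"
  have "(\<Sum>l = 1..?n. summand_ext s (?n - l) l (\<lambda>xs ys. f (xs @ ys)) zs) = (\<Sum>l = 1..?n. ?T (?n - l))"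
    by (rule sum.cong) (auto simp: summand_ext_eq[OF assms(1)])
  also have "\<dots> = (\<Sum>k<?n. ?T k)" by (rule sum_reverse_atLeast1)
  also have "\<dots> = (\<Sum>k\<le>?n. ?T k) - f (map fst zs)"
    by (simp add: lessThan_Suc_atMost[symmetric] unshuffle_sum_length)
  also have "(\<Sum>k\<le>?n. ?T k) = f (map (\<lambda>z. fst z + snd z) zs)"
    by (rule alt_form_map_add[OF assms(2), symmetric])
  finally show ?thesis
    by (simp add: iota_M_def emb_left_def emb_right_def summand_ext_left[OF assms(1)] prod_eq_iff
        fst_sum snd_sum)
qed

lemma iota_A_eq: "vector_space sW \<Longrightarrow> iota_A sW f zs = (0, f (map fst zs))"
  by (simp add: iota_A_def emb_right_def summand_ext_left)

section \<open>Linear structure of the product and transport of alternating maps\<close>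

lemma scale_prod_eq:
  assumes "vector_space sV" "vector_space sW"
  shows "module_prod.scale sV sW c z = (sV c (fst z), sW c (snd z))"
proof -
  interpret vector_space_prod sV sW by (simp add: vector_space_prod_def vector_space_pair_def assms)
  show ?thesis by (simp add: scale_def)
qed

lemma vector_space_prod_scale:
  assumes "vector_space sV" "vector_space sW"
  shows "vector_space (module_prod.scale sV sW)"
proof -
  interpret vector_space_prod sV sW by (simp add: vector_space_prod_def vector_space_pair_def assms)
  show ?thesis by unfold_locales
qed

lemma linear_prod_maps:
  assumes "vector_space sV" "vector_space sW"
  shows "Vector_Spaces.linear (module_prod.scale sV sW) sV fst"
    "Vector_Spaces.linear (module_prod.scale sV sW) sW snd"
    "Vector_Spaces.linear sV (module_prod.scale sV sW) (\<lambda>x. (x, 0))"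
    "Vector_Spaces.linear sW (module_prod.scale sV sW) (\<lambda>y. (0, y))"
  using assms vector_space_prod_scale[OF assms]
  by (simp_all add: Vector_Spaces.linear_iff scale_prod_eq[OF assms]
      module.scale_zero_right module_iff_vector_space)

lemma linear_fst_plus_snd:
  "vector_space s \<Longrightarrow> Vector_Spaces.linear (module_prod.scale s s) s (\<lambda>z. fst z + snd z)"
  using vector_space_prod_scale[of s s]
  by (simp add: Vector_Spaces.linear_iff scale_prod_eq vector_space.vector_space_assms algebra_simps)

lemma wedge_tensor_hom_summand_ext:
  assumes "vector_space sV" "vector_space sW" "vector_space sX" "F \<in> wedge_tensor_hom sV sW sX k l"
  shows "summand_ext sX k l F \<in> wedge_hom (module_prod.scale sV sW) sX (k + l)"
proof -
  let ?s = "module_prod.scale sV sW"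
  have vs: "vector_space ?s" by (rule vector_space_prod_scale[OF assms(1,2)])
  note lin = linear_prod_maps[OF assms(1,2)]
  have F: "alt_form sV sX (\<lambda>xs. F xs ys)" "alt_form sW sX (F xs)"
    "length xs \<noteq> k \<or> length ys \<noteq> l \<Longrightarrow> F xs ys = 0" for xs ys
    using assms(4) unfolding wedge_tensor_hom_def wedge_hom_iff[OF assms(1,3)] wedge_hom_iff[OF assms(2,3)]
    by auto
  have "summand_ext sX k l F = (\<lambda>zs. unshuffle_sum k zs (\<lambda>as bs. F (map fst as) (map snd bs)))"
    unfolding fun_eq_iff summand_ext_eq[OF assms(3)]
    by (auto intro!: unshuffle_sum_eq_0 F(3))
  moreover have "alt_form ?s sX (\<lambda>zs. unshuffle_sum k zs (\<lambda>as bs. F (map fst as) (map snd bs)))"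
    by (rule alt_form_unshuffle_sum[OF assms(3)])
      (intro alt_form_map[OF F(1) lin(1)] alt_form_map[OF F(2) lin(2)])+
  ultimately have "alt_form ?s sX (summand_ext sX k l F)" by simp
  then show ?thesis by (auto simp: wedge_hom_iff[OF vs assms(3)] summand_ext_def)
qed

lemma wedge_hom_comp:
  assumes "f \<in> wedge_hom sV sX k" "Vector_Spaces.linear sX sY \<phi>" "vector_space sV"
  shows "(\<lambda>xs. \<phi> (f xs)) \<in> wedge_hom sV sY k"
proof -
  have vs: "vector_space sX" "vector_space sY" using assms(2) by (simp_all add: Vector_Spaces.linear_iff)
  have "\<phi> 0 = 0" using assms(2) by (metis Vector_Spaces.linear_iff add_cancel_right_right)
  then show ?thesis
    using assms(1) alt_form_comp[OF _ assms(2)]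
    unfolding wedge_hom_iff[OF assms(3) vs(1)] wedge_hom_iff[OF assms(3) vs(2)]
    by auto
qed

lemma wedge_hom_map:
  assumes "f \<in> wedge_hom sW sX k" "Vector_Spaces.linear sV sW \<phi>" "vector_space sX"
  shows "(\<lambda>xs. f (map \<phi> xs)) \<in> wedge_hom sV sX k"
proof -
  have vs: "vector_space sV" "vector_space sW" using assms(2) by (simp_all add: Vector_Spaces.linear_iff)
  show ?thesis
    using assms(1) alt_form_map[OF _ assms(2)]
    unfolding wedge_hom_iff[OF vs(1) assms(3)] wedge_hom_iff[OF vs(2) assms(3)]
    by auto
qed

lemma Hom_comp_map_comp:
  assumes "f \<in> Hom_comp sW sX n" "Vector_Spaces.linear sV sW \<phi>" "Vector_Spaces.linear sX sY \<psi>"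
  shows "(\<lambda>xs. \<psi> (f (map \<phi> xs))) \<in> Hom_comp sV sY n"
proof -
  have vs: "vector_space sV" "vector_space sW" "vector_space sX" "vector_space sY"
    using assms(2,3) by (simp_all add: Vector_Spaces.linear_iff)
  have "\<psi> 0 = 0" using assms(3) by (metis Vector_Spaces.linear_iff add_cancel_right_right)
  then show ?thesis
    using assms(1) wedge_hom_comp[OF wedge_hom_map[OF _ assms(2)] assms(3) vs(1)] vs(3)
    by (auto simp: Hom_comp_def zero_fun_def)
qed

lemma alt_form_Pair:
  assumes "vector_space sX" "vector_space sY" "alt_form sV sX f" "alt_form sV sY g"
  shows "alt_form sV (module_prod.scale sX sY) (\<lambda>xs. (f xs, g xs))"
  using assms(3,4) by (simp add: alt_form_def scale_prod_eq[OF assms(1,2)] zero_prod_def)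

lemma alt_form_iota_M:
  assumes "vector_space s" "alt_form s s f"
  shows "alt_form (module_prod.scale s s) (module_prod.scale s s) (iota_M s f)"
proof -
  have "iota_M s f = (\<lambda>zs. (f (map fst zs), f (map (\<lambda>z. fst z + snd z) zs) - f (map fst zs)))"
    using iota_M_eq[OF assms] by (rule ext)
  then show ?thesis
    using alt_form_map[OF assms(2) linear_prod_maps(1)[OF assms(1,1)]]
      alt_form_map[OF assms(2) linear_fst_plus_snd[OF assms(1)]] assms(1)
    by (simp add: alt_form_Pair alt_form_minus)
qed

lemma iota_M_Hom_comp:
  assumes "vector_space s" "f \<in> Hom_comp s s n"
  shows "iota_M s f \<in> Hom_comp (module_prod.scale s s) (module_prod.scale s s) n"
proof -
  note vs = vector_space_prod_scale[OF assms(1,1)]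
  note alt = Hom_comp_alt_form[OF assms(1,1,2)]
  have "iota_M s f zs = 0" if "n < 0 \<or> int (length zs) \<noteq> n + 1" for zs
    using Hom_comp_length[OF assms(2)] that by (simp add: iota_M_eq[OF assms(1) alt] zero_prod_def)
  then show ?thesis
    using alt_form_iota_M[OF assms(1) alt] by (intro Hom_compI vs)
qed

lemma iota_A_Hom_comp:
  assumes "vector_space sV" "vector_space sW" "f \<in> Hom_comp sV sW n"
  shows "iota_A sW f \<in> Hom_comp (module_prod.scale sV sW) (module_prod.scale sV sW) n"
proof -
  have "iota_A sW f = (\<lambda>zs. (0, f (map fst zs)))" using iota_A_eq[OF assms(2)] by (rule ext)
  then show ?thesis using Hom_comp_map_comp[OF assms(3) linear_prod_maps(1,4)[OF assms(1,2)]] by simp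
qed

lemma proj_A_Hom_comp:
  assumes "vector_space sV" "vector_space sW"
    "F \<in> Hom_comp (module_prod.scale sV sW) (module_prod.scale sV sW) n"
  shows "proj_A F \<in> Hom_comp sV sW n"
  using Hom_comp_map_comp[OF assms(3) linear_prod_maps(3,2)[OF assms(1,2)]]
  by (simp add: proj_A_def)

text \<open>The component of \<open>f\<close> on the summand of bidegree \<open>(k, l)\<close>. The
  length test is part of it because \<open>f\<close> itself may be nonzero on blocks of other
  lengths.\<close>

lemma wedge_tensor_hom_split:
  assumes "vector_space sV" "vector_space sW" "vector_space sX" "alt_form (module_prod.scale sV sW) sX f"
  shows "(\<lambda>xs ys. if length xs = k \<and> length ys = l then f (map (\<lambda>x. (x, 0)) xs @ map (\<lambda>y. (0, y)) ys) else 0)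
    \<in> wedge_tensor_hom sV sW sX k l"
proof -
  \<comment> \<open>The proposition \<open>P\<close> absorbs the length condition on the block that
    is held fixed.\<close>
  have wh: "(\<lambda>xs. if length xs = m \<and> P then g xs else 0) \<in> wedge_hom sU sX m"
    if "vector_space sU" "alt_form sU sX g" for P m g and sU :: "'a \<Rightarrow> 'u::ab_group_add \<Rightarrow> 'u"
  proof (cases P)
    case True
    have "module sX" using assms(3) by (simp add: module_iff_vector_space)
    then show ?thesis using that(2) True unfolding wedge_hom_iff[OF that(1) assms(3)] alt_form_def
      by (simp add: module.scale_zero_right)
  next
    case False
    then show ?thesis using wedge_hom_subspace(1)[OF that(1) assms(3)] by (simp add: zero_fun_def)
  qed
  note lin = linear_prod_maps[OF assms(1,2)]
  show ?thesis
    unfolding wedge_tensor_hom_def mem_Collect_eq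
  proof (intro conjI allI)
    show "(\<lambda>xs. if length xs = k \<and> length ys = l then f (map (\<lambda>x. (x, 0)) xs @ map (\<lambda>y. (0, y)) ys) else 0)
      \<in> wedge_hom sV sX k" for ys
      by (intro wh[OF assms(1)] alt_form_map[OF _ lin(3)] alt_form_append_right assms(4))
    show "(\<lambda>ys. if length xs = k \<and> length ys = l then f (map (\<lambda>x. (x, 0)) xs @ map (\<lambda>y. (0, y)) ys) else 0)
      \<in> wedge_hom sW sX l" for xs
      using wh[OF assms(2) alt_form_map[OF alt_form_append[OF assms(4)] lin(4)]] by (simp add: conj_commute)
  qed
qed

section \<open>The subalgebra of the relative datum\<close>

text \<open>The only summand of M' with values in g takes all arguments from g, so the first
  component factors through \<open>fst\<close>. The summand with values in h and all arguments from
  g is missing, so the second component vanishes on g. These two conditions are easier to propagate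
  through brackets than the decomposition itself.\<close>

lemma relative_M_comp_iff:
  assumes "vector_space sg" "vector_space sh"
  defines "sp \<equiv> module_prod.scale sg sh"
  shows "F \<in> relative_M_comp sg sh n \<longleftrightarrow> F \<in> Hom_comp sp sp n \<and>
    (\<exists>f. \<forall>zs. fst (F zs) = f (map fst zs)) \<and> (\<forall>xs. snd (F (map (\<lambda>x. (x, 0)) xs)) = 0)"
proof (cases "n < 0")
  case True
  then show ?thesis by (auto simp: relative_M_comp_def Hom_comp_def)
next
  case False
  then obtain m where n: "n = int m" using nonneg_int_cases[of n] by auto
  define N where "N = Suc m"
  have vp: "vector_space sp" unfolding sp_def by (rule vector_space_prod_scale[OF assms(1,2)])
  interpret H: module "Hom_scale sp"
    using vector_space_Hom_scale[OF vp] by (simp add: module_iff_vector_space)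
  note lin = linear_prod_maps[OF assms(1,2), folded sp_def]
  define G where "G a b c = emb_left sg N 0 a +
    (\<Sum>l = 1..<N. emb_right sh (N - l) l (b l)) + emb_right sh 0 N c"
    for a b c
  have rel: "F \<in> relative_M_comp sg sh n \<longleftrightarrow> (\<exists>a b c. F = G a b c \<and> a \<in> wedge_tensor_hom sg sh sg N 0 \<and>
      (\<forall>l\<in>{1..<N}. b l \<in> wedge_tensor_hom sg sh sh (N - l) l) \<and> c \<in> wedge_tensor_hom sg sh sh 0 N)"
    by (simp add: relative_M_comp_def n N_def Let_def G_def)
  have G_fst: "fst (G a b c zs) = summand_ext sg N 0 a zs" for a b c zs
    by (simp add: G_def emb_left_def emb_right_def sum_fun_apply fst_sum)
  have G_snd: "snd (G a b c zs) = (\<Sum>l = 1..<N. summand_ext sh (N - l) l (b l) zs) + summand_ext sh 0 N c zs"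
    for a b c zs
    by (simp add: G_def emb_left_def emb_right_def sum_fun_apply snd_sum)
  show ?thesis
  proof (intro iffI conjI)
    assume "F \<in> relative_M_comp sg sh n"
    then obtain a b c where F: "F = G a b c" and a: "a \<in> wedge_tensor_hom sg sh sg N 0"
      and b: "\<And>l. l \<in> {1..<N} \<Longrightarrow> b l \<in> wedge_tensor_hom sg sh sh (N - l) l"
      and c: "c \<in> wedge_tensor_hom sg sh sh 0 N"
      unfolding rel by blast
    have right: "emb_right sh k l H \<in> wedge_hom sp sp N"
      if "H \<in> wedge_tensor_hom sg sh sh k l" "k + l = N" for k l H
      using wedge_hom_comp[OF wedge_tensor_hom_summand_ext[OF assms(1,2,2) that(1), folded sp_def] lin(4) vp]
        that(2)
      by (simp add: emb_right_def)
    have "emb_left sg N 0 a \<in> wedge_hom sp sp N"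
      using wedge_hom_comp[OF wedge_tensor_hom_summand_ext[OF assms(1,2,1) a, folded sp_def] lin(3) vp]
      by (simp add: emb_left_def)
    moreover have "H.subspace (wedge_hom sp sp N)"
      using subspace_Hom_comp[OF vp vp, of n] by (simp add: n N_def)
    ultimately have "G a b c \<in> wedge_hom sp sp N"
      unfolding G_def by (intro H.subspace_add H.subspace_sum right b c) auto
    then show "F \<in> Hom_comp sp sp n" by (simp add: F n N_def)
    show "\<exists>f. \<forall>zs. fst (F zs) = f (map fst zs)"
      unfolding F G_fst summand_ext_left[OF assms(1)]
      by (rule exI[of _ "\<lambda>xs. if length xs = N then a xs [] else 0"]) simp
    \<comment> \<open>For positive \<open>l\<close> the second block is nonempty and consists of
      zeros.\<close>
    have "summand_ext sh k l H (map (\<lambda>x. (x, 0)) xs) = 0"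
      if "H \<in> wedge_tensor_hom sg sh sh k l" "0 < l" for k l H xs
    proof -
      have "H as (map (\<lambda>_. 0) bs) = 0" if "bs \<noteq> []" for as and bs :: "'b list"
      proof -
        have "alt_form sh sh (H as)"
          using \<open>H \<in> wedge_tensor_hom sg sh sh k l\<close>
          unfolding wedge_tensor_hom_def wedge_hom_iff[OF assms(2,2)] by auto
        then show ?thesis using that by (cases bs) (auto intro: alt_form_zero_hd)
      qed
      then show ?thesis
        using that(2)
        by (auto simp: summand_ext_eq[OF assms(2)] unshuffle_sum_map o_def intro!: unshuffle_sum_eq_0)
    qed
    then show "\<forall>xs. snd (F (map (\<lambda>x. (x, 0)) xs)) = 0"
      using b c unfolding F G_snd by (simp add: N_def)
  next
    assume *: "F \<in> Hom_comp sp sp n \<and> (\<exists>f. \<forall>zs. fst (F zs) = f (map fst zs)) \<and>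
      (\<forall>xs. snd (F (map (\<lambda>x. (x, 0)) xs)) = 0)"
    then obtain f where f: "\<And>zs. fst (F zs) = f (map fst zs)" by blast
    from * have alt: "alt_form sp sp F" and len: "\<And>zs. length zs \<noteq> N \<Longrightarrow> F zs = 0"
      using wedge_hom_iff[OF vp vp] by (auto simp: n N_def)
    have s0: "snd (F (map (\<lambda>x. (x, 0)) xs)) = 0" for xs using * by blast
    let ?i = "map (\<lambda>x. (x, 0))" and ?j = "map (\<lambda>y. (0, y))"
    \<comment> \<open>The candidates for the summands are the components of \<open>F\<close>, read
      off on pure vectors from g and h.\<close>
    define A where "A k l xs ys = (if length xs = k \<and> length ys = l then fst (F (?i xs @ ?j ys)) else 0)"
      for k l xs ys
    define B where "B k l xs ys = (if length xs = k \<and> length ys = l then snd (F (?i xs @ ?j ys)) else 0)"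
      for k l xs ys
    have AB: "A k l \<in> wedge_tensor_hom sg sh sg k l" "B k l \<in> wedge_tensor_hom sg sh sh k l" for k l
      using wedge_tensor_hom_split[OF assms(1,2,1) alt_form_comp[OF alt lin(1), unfolded sp_def]]
        wedge_tensor_hom_split[OF assms(1,2,2) alt_form_comp[OF alt lin(2), unfolded sp_def]]
      unfolding A_def[abs_def] B_def[abs_def] by blast+
    have "F = G (A N 0) (\<lambda>l. B (N - l) l) (B 0 N)" (is "F = ?G")
    proof
      fix zs
      show "F zs = ?G zs"
      proof (cases "length zs = N")
        case False
        then show ?thesis
          using len[OF False]
          by (simp add: prod_eq_iff G_fst G_snd summand_ext_def)
      next
        case True
        let ?T = "\<lambda>k. unshuffle_sum k zs
          (\<lambda>as bs. snd (F (map (\<lambda>z. (fst z, 0)) as @ map (\<lambda>z. (0, snd z)) bs)))"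
        have "fst (F zs) = fst (?G zs)"
          using True by (simp add: G_fst summand_ext_left[OF assms(1)] A_def f o_def)
        moreover have "snd (F zs) = snd (?G zs)"
        proof -
          have T: "summand_ext sh (N - l) l (B (N - l) l) zs = ?T (N - l)" if "l \<le> N" for l
            using that True
            by (auto simp: summand_ext_eq[OF assms(2)] B_def o_def intro!: unshuffle_sum_cong)
          \<comment> \<open>Splitting every argument into its g-part and its h-part turns the
            multilinear expansion into the decomposition by bidegree.\<close>
          have "snd (F zs) = snd (F (map (\<lambda>z. (fst z, 0) + (0, snd z)) zs))" by simp
          also have "\<dots> = (\<Sum>k\<le>N. ?T k)"
            using alt_form_map_add[OF alt_form_comp[OF alt lin(2)],
                of "\<lambda>z. (fst z, 0)" "\<lambda>z. (0, snd z)" zs] unfolding True .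
          \<comment> \<open>The term \<open>k = N\<close> has all arguments in g and vanishes by
            assumption.\<close>
          also have "\<dots> = (\<Sum>k<N. ?T k)"
            using s0[of "map fst zs"] True
              unshuffle_sum_length[of zs
                "\<lambda>as bs. snd (F (map (\<lambda>z. (fst z, 0)) as @ map (\<lambda>z. (0, snd z)) bs))"]
            by (simp add: lessThan_Suc_atMost[symmetric] o_def)
          also have "\<dots> = (\<Sum>l = 1..N. ?T (N - l))"
            by (rule sum_reverse_atLeast1[symmetric])
          \<comment> \<open>The term \<open>l = N\<close>, with all arguments in h, is split off
            since it is the separate summand \<open>c\<close> of M'.\<close>
          also have "\<dots> = (\<Sum>l = 1..<N. ?T (N - l)) + ?T (N - N)"
            using sum.last_plus[of 1 N "\<lambda>l. ?T (N - l)"]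
            by (simp add: N_def atLeastLessThanSuc_atLeastAtMost[symmetric])
          also have "\<dots> = snd (?G zs)"
            unfolding G_snd using T[of N] by (intro arg_cong2[of _ _ _ _ plus] sum.cong) (auto simp: T)
          finally show ?thesis .
        qed
        ultimately show ?thesis by (simp add: prod_eq_iff)
      qed
    qed
    then show "F \<in> relative_M_comp sg sh n" unfolding rel using AB by blast
  qed
qed

lemma iota_M_relative_M_comp:
  assumes "vector_space s" "f \<in> Hom_comp s s n"
  shows "iota_M s f \<in> relative_M_comp s s n"
proof -
  note eq = iota_M_eq[OF assms(1) Hom_comp_alt_form[OF assms(1,1,2)]]
  show ?thesis
    unfolding relative_M_comp_iff[OF assms(1,1)]
    using iota_M_Hom_comp[OF assms] by (auto simp: eq o_def)
qed

lemma additive_fst: "Modules.additive fst" and additive_snd: "Modules.additive snd"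
  and additive_Pair_0: "Modules.additive (\<lambda>x. (x, 0))"
  by (simp_all add: additive.intro)

text \<open>The hypotheses say that \<open>F\<close> and \<open>G\<close> restrict to operations on
  g. The inclusion of g intertwines these restrictions with \<open>F\<close> and \<open>G\<close>,
  so the bracket restricts to the bracket of the restrictions.\<close>

lemma NR_bracket_preserves_fst:
  assumes "vector_space sg" "vector_space sh"
    "\<forall>xs. snd (F (map (\<lambda>x. (x, 0)) xs)) = 0" "\<forall>xs. snd (G (map (\<lambda>x. (x, 0)) xs)) = 0"
  shows "snd (NR_bracket (module_prod.scale sg sh) F G (map (\<lambda>x. (x, 0)) xs)) = 0"
proof -
  let ?i = "\<lambda>x. (x, 0)"
  have "?i (NR_bracket sg (\<lambda>xs. fst (F (map ?i xs))) (\<lambda>xs. fst (G (map ?i xs))) xs) =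
      NR_bracket (module_prod.scale sg sh) F G (map ?i xs)"
    by (rule NR_bracket_intertwine[OF assms(1) vector_space_prod_scale[OF assms(1,2)] additive_Pair_0])
      (use assms(3,4) in \<open>simp_all add: prod_eq_iff\<close>)
  then show ?thesis by (metis snd_conv)
qed

text \<open>Lying in the kernel means being restrictable to g, which brackets inherit.\<close>

lemma graded_Lie_subalgebra_ker_proj_A:
  assumes "vector_space sg" "vector_space sh"
  defines "sp \<equiv> module_prod.scale sg sh"
  shows "graded_Lie_subalgebra (NR_algebra sp) (gker (NR_algebra sp) proj_A)"
proof -
  have vp: "vector_space sp" unfolding sp_def by (rule vector_space_prod_scale[OF assms(1,2)])
  have K: "F \<in> gker (NR_algebra sp) proj_A n \<longleftrightarrow>
      F \<in> Hom_comp sp sp n \<and> (\<forall>xs. snd (F (map (\<lambda>x. (x, 0)) xs)) = 0)" for F n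
    by (simp add: gker_def NR_algebra_def proj_A_def fun_eq_iff)
  note sub = subspace_Hom_comp[OF vp vp, unfolded subspace_iff[OF vector_space_Hom_scale[OF vp]]]
  have z: "sh c 0 = 0" for c
    using assms(2) by (simp add: module.scale_zero_right module_iff_vector_space)
  have "module.subspace (Hom_scale sp) (gker (NR_algebra sp) proj_A n)" for n
    unfolding subspace_iff[OF vector_space_Hom_scale[OF vp]]
    using sub[of n] z
    by (auto simp: K) (simp add: Hom_scale_def sp_def scale_prod_eq[OF assms(1,2)])
  moreover have "gker (NR_algebra sp) proj_A n \<subseteq> gcomp (NR_algebra sp) n" for n
    by (auto simp: gker_def)
  moreover have "NR_bracket sp F G \<in> gker (NR_algebra sp) proj_A (p + q)"
    if "F \<in> gker (NR_algebra sp) proj_A p" "G \<in> gker (NR_algebra sp) proj_A q" for F G p q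
    using that NR_bracket_Hom_comp[OF vp] NR_bracket_preserves_fst[OF assms(1,2), folded sp_def]
    unfolding K by blast
  ultimately show ?thesis
    unfolding graded_Lie_subalgebra_def by (simp add: NR_algebra_def)
qed

lemma graded_Lie_subalgebra_relative_M:
  assumes "vector_space sg" "vector_space sh"
  defines "sp \<equiv> module_prod.scale sg sh"
  shows "graded_Lie_subalgebra (NR_algebra sp) (relative_M_comp sg sh)"
proof -
  have vp: "vector_space sp" unfolding sp_def by (rule vector_space_prod_scale[OF assms(1,2)])
  note K = relative_M_comp_iff[OF assms(1,2), folded sp_def]
  note sub = subspace_Hom_comp[OF vp vp, unfolded subspace_iff[OF vector_space_Hom_scale[OF vp]]]
  have z: "sh c 0 = 0" for c
    using assms(2) by (simp add: module.scale_zero_right module_iff_vector_space)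
  have "module.subspace (Hom_scale sp) (relative_M_comp sg sh n)" for n
    unfolding subspace_iff[OF vector_space_Hom_scale[OF vp]]
  proof (intro conjI ballI allI)
    show "0 \<in> relative_M_comp sg sh n" using sub unfolding K by auto
  next
    fix F G assume *: "F \<in> relative_M_comp sg sh n" "G \<in> relative_M_comp sg sh n"
    then obtain f g where "\<And>zs. fst (F zs) = f (map fst zs)" "\<And>zs. fst (G zs) = g (map fst zs)"
      unfolding K by blast
    then have "\<forall>zs. fst ((F + G) zs) = (\<lambda>xs. f xs + g xs) (map fst zs)" by simp
    then show "F + G \<in> relative_M_comp sg sh n" using * sub[of n] unfolding K by auto
  next
    fix c F assume *: "F \<in> relative_M_comp sg sh n"
    then obtain f where "\<And>zs. fst (F zs) = f (map fst zs)" unfolding K by blast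
    then have "\<exists>f. \<forall>zs. fst (Hom_scale sp c F zs) = f (map fst zs)"
      by (intro exI[of _ "\<lambda>xs. sg c (f xs)"]) (simp add: Hom_scale_def sp_def scale_prod_eq[OF assms(1,2)])
    moreover have "snd (Hom_scale sp c F (map (\<lambda>x. (x, 0)) xs)) = 0" for xs
      using * z unfolding K
      by (simp add: Hom_scale_def sp_def scale_prod_eq[OF assms(1,2)])
    ultimately show "Hom_scale sp c F \<in> relative_M_comp sg sh n" using * sub[of n] unfolding K by blast
  qed
  moreover have "relative_M_comp sg sh n \<subseteq> Hom_comp sp sp n" for n using K by blast
  moreover have "NR_bracket sp F G \<in> relative_M_comp sg sh (p + q)"
    if *: "F \<in> relative_M_comp sg sh p" "G \<in> relative_M_comp sg sh q" for F G p q
  proof -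
    obtain f g where "\<And>zs. fst (F zs) = f (map fst zs)" "\<And>zs. fst (G zs) = g (map fst zs)"
      using * unfolding K by blast
    \<comment> \<open>The operations descend to \<open>f\<close> and \<open>g\<close> along
      \<open>fst\<close>, so their bracket descends to the bracket of \<open>f\<close> and
      \<open>g\<close>.\<close>
    then have "\<forall>zs. fst (NR_bracket sp F G zs) = NR_bracket sg f g (map fst zs)"
      using NR_bracket_intertwine[OF vp assms(1) additive_fst] by blast
    moreover have "snd (NR_bracket sp F G (map (\<lambda>x. (x, 0)) xs)) = 0" for xs
      using * unfolding K sp_def by (intro NR_bracket_preserves_fst[OF assms(1,2)]) auto
    ultimately show ?thesis
      using * NR_bracket_Hom_comp[OF vp] unfolding K by blast
  qed
  ultimately show ?thesis unfolding graded_Lie_subalgebra_def by (simp add: NR_algebra_def)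
qed

section \<open>The embedding \<open>iota_M\<close> respects brackets and sums and is
  injective\<close>

lemma alt_form_NR_bracket:
  assumes "vector_space s" "alt_form s s f" "alt_form s s g"
  shows "alt_form s s (NR_bracket s f g)"
proof -
  interpret vector_space s by fact
  have alt: "alt_form s s (NR_comm p q f g)" for p q
    unfolding NR_comm_def by (intro alt_form_minus alt_form_signed alt_form_insertion assms)
  show ?thesis
    unfolding alt_form_def[of s s "NR_bracket s f g"]
    by (simp add: NR_bracket_eq[OF assms(1)] alt_form_add[OF alt] alt_form_scale[OF alt]
        alt_form_alt[OF alt] case_prod_unfold
        sum.distrib scale_sum_right)
qed

text \<open>A vector of the product is determined by \<open>fst\<close> and
  \<open>fst + snd\<close>. By \<open>iota_M_eq\<close> each of these maps intertwines
  \<open>iota_M s f\<close> with \<open>f\<close>, hence also the brackets.\<close>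

lemma iota_M_bracket:
  assumes "vector_space s" "alt_form s s f" "alt_form s s g"
  shows "iota_M s (NR_bracket s f g) = NR_bracket (module_prod.scale s s) (iota_M s f) (iota_M s g)"
proof
  fix zs
  let ?B = "NR_bracket (module_prod.scale s s) (iota_M s f) (iota_M s g)"
  note vp = vector_space_prod_scale[OF assms(1,1)]
  note eq = iota_M_eq[OF assms(1)]
  have "fst (?B zs) = NR_bracket s f g (map fst zs)"
    by (rule NR_bracket_intertwine[OF vp assms(1) additive_fst]) (simp_all add: eq assms)
  moreover have "fst (?B zs) + snd (?B zs) = NR_bracket s f g (map (\<lambda>z. fst z + snd z) zs)"
    by (rule NR_bracket_intertwine[OF vp assms(1), of "\<lambda>z. fst z + snd z"])
      (simp_all add: eq assms additive.intro)
  ultimately show "iota_M s (NR_bracket s f g) zs = ?B zs"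
    by (simp add: eq[OF alt_form_NR_bracket[OF assms]] prod_eq_iff algebra_simps)
qed

lemma iota_M_add:
  assumes "vector_space s" "alt_form s s f" "alt_form s s g"
  shows "iota_M s (f + g) = iota_M s f + iota_M s g"
  using iota_M_eq[OF assms(1)] alt_form_plus[OF assms] assms
  by (simp add: fun_eq_iff plus_fun_def)

lemma iota_M_scale:
  assumes "vector_space s" "alt_form s s f"
  shows "iota_M s (Hom_scale s c f) = Hom_scale (module_prod.scale s s) c (iota_M s f)"
proof -
  interpret vector_space s by fact
  show ?thesis
    using iota_M_eq[OF assms(1)] alt_form_scaled[OF assms, of c] assms
    by (simp add: fun_eq_iff Hom_scale_def scale_prod_eq scale_right_diff_distrib)
qed

text \<open>The first component of \<open>iota_M s f\<close> on vectors of the form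
  \<open>(x, 0)\<close> recovers \<open>f\<close>.\<close>

lemma iota_M_inject:
  assumes "vector_space s" "alt_form s s f" "alt_form s s g" "iota_M s f = iota_M s g"
  shows "f = g"
proof
  fix xs
  have "fst (iota_M s f (map (\<lambda>x. (x, 0)) xs)) = fst (iota_M s g (map (\<lambda>x. (x, 0)) xs))"
    using assms(4) by simp
  then show "f xs = g xs" by (simp add: iota_M_eq assms(1-3) o_def)
qed

section \<open>The two generalised V-data and the induced homomorphism\<close>

lemma zero_in_gtotal: "module (gscale V) \<Longrightarrow> 0 \<in> gtotal V"
  by (simp add: gtotal_def module.span_zero)

text \<open>Treats both data at once: they share the shape of L, A and P and differ in M and its
  embedding \<open>im\<close>.\<close>

lemma generalised_V_datum_Hom:
  fixes sg :: "'k::field \<Rightarrow> 'g::ab_group_add \<Rightarrow> 'g" and sh :: "'k \<Rightarrow> 'h::ab_group_add \<Rightarrow> 'h"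
  assumes "vector_space sg" "vector_space sh"
  defines "sp \<equiv> module_prod.scale sg sh"
  assumes "graded_Lie_algebra M" "graded_Lie_hom M (NR_algebra sp) im" "inj_on im (gtotal M)"
    "\<And>m. m \<in> gtotal M \<Longrightarrow> alt_form sp sp (im m)"
  shows "generalised_V_datum \<lparr>dL = NR_algebra sp, dM = M, iM = im, dA = abelian_Hom sg sh,
    iA = iota_A sh, dP = proj_A, dDelta = 0\<rparr>"
proof -
  have vp: "vector_space sp" unfolding sp_def by (rule vector_space_prod_scale[OF assms(1,2)])
  have sp: "sp c z = (sg c (fst z), sh c (snd z))" for c z
    unfolding sp_def by (rule scale_prod_eq[OF assms(1,2)])
  have sg0: "sg c 0 = 0" for c
    using assms(1) by (simp add: module.scale_zero_right module_iff_vector_space)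
  note eqA = iota_A_eq[OF assms(2)]
  have totA: "alt_form sg sh f" if "f \<in> gtotal (abelian_Hom sg sh)" for f
    using gtotal_alt_form[OF assms(1,2) _ _ that] by (simp add: abelian_Hom_def)
  have "NR_bracket sp (iota_A sh f) (iota_A sh g) = 0" if "alt_form sg sh f" "alt_form sg sh g" for f g
  proof -
    \<comment> \<open>The inner map takes values in 0 x h, while the outer one reads only first
      coordinates, so \<open>f\<close> is evaluated with 0 in its first slot.\<close>
    have "insertion k (iota_A sh f) (iota_A sh g) xs = 0" if "alt_form sg sh f" for k f g xs
      using alt_form_zero_hd[OF that] by (simp add: insertion_def eqA zero_prod_def[symmetric])
    then show ?thesis
      using that by (auto simp: fun_eq_iff NR_bracket_eq[OF vp] NR_comm_def signed_def intro!: sum.neutral)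
  qed
  then have A: "graded_Lie_hom (abelian_Hom sg sh) (NR_algebra sp) (iota_A sh)"
    using totA iota_A_Hom_comp[OF assms(1,2)]
    by (auto simp: graded_Lie_hom_def graded_linear_map_def abelian_Hom_def NR_algebra_def
        fun_eq_iff eqA Hom_scale_def sp sg0 sp_def[symmetric] zero_prod_def[symmetric])
  have PA: "proj_A (iota_A sh f) = f" for f :: "'g list \<Rightarrow> 'h"
    by (simp add: proj_A_def eqA o_def)
  then have inj: "inj_on (iota_A sh) (gtotal (abelian_Hom sg sh))"
    by (metis inj_on_inverseI)
  have P: "graded_linear_map (NR_algebra sp) (abelian_Hom sg sh) proj_A"
    using proj_A_Hom_comp[OF assms(1,2)]
    by (auto simp: graded_linear_map_def abelian_Hom_def NR_algebra_def proj_A_def fun_eq_iff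
        Hom_scale_def sp sp_def[symmetric])
  have zero: "0 \<in> gker (NR_algebra sp) proj_A 1"
    using subspace_Hom_comp[OF vp vp]
    by (simp add: gker_def NR_algebra_def proj_A_def fun_eq_iff
        subspace_iff[OF vector_space_Hom_scale[OF vp]])
  have tot0: "0 \<in> gtotal M"
    using assms(4) unfolding graded_Lie_algebra_def graded_vector_space_def
    by (intro zero_in_gtotal) (simp add: module_iff_vector_space)
  \<comment> \<open>For Delta = 0 the stability condition says that 0 lies in the image of
    \<open>im\<close>; additivity gives \<open>im 0 = 0\<close>.\<close>
  then have "im (0 + 0) = im 0 + im 0"
    using assms(5) unfolding graded_Lie_hom_def graded_linear_map_def by blast
  then have "0 \<in> im ` gtotal M" using tot0 by (metis add_cancel_right_right image_eqI)
  then have "\<forall>m\<in>gtotal M. NR_bracket sp 0 (im m) \<in> im ` gtotal M"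
    using NR_bracket_0(1)[OF vp assms(7)] by simp
  moreover have "NR_bracket sp 0 0 = 0"
    using NR_bracket_0(1)[OF vp alt_form_0[OF vp, of sp]] by (simp add: zero_fun_def)
  ultimately show ?thesis
    unfolding generalised_V_datum_def
    using graded_Lie_NR_algebra[OF vp] assms(4-6) abelian_graded_Lie_Hom[OF assms(1,2)] A inj P PA zero
      graded_Lie_subalgebra_ker_proj_A[OF assms(1,2), folded sp_def]
    by (simp add: NR_algebra_def)
qed

lemma graded_Lie_hom_id_subalgebra:
  assumes "\<And>n. K n \<subseteq> gcomp L n"
  shows "graded_Lie_hom (L\<lparr>gcomp := K\<rparr>) L id"
  using assms by (auto simp: graded_Lie_hom_def graded_linear_map_def)

text \<open>Written as L' with smaller components, so that the lemmas on subalgebras apply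
  directly.\<close>

definition relative_M :: "('k::field \<Rightarrow> 'g::ab_group_add \<Rightarrow> 'g) \<Rightarrow> ('k \<Rightarrow> 'h::ab_group_add \<Rightarrow> 'h) \<Rightarrow>
    ('k, ('g \<times> 'h) list \<Rightarrow> 'g \<times> 'h) graded_Lie" where
  "relative_M sg sh = (NR_algebra (module_prod.scale sg sh))\<lparr>gcomp := relative_M_comp sg sh\<rparr>"

lemma relative_datum_eq:
  "relative_datum sg sh = \<lparr>dL = NR_algebra (module_prod.scale sg sh), dM = relative_M sg sh, iM = id,
     dA = abelian_Hom sg sh, iA = iota_A sh, dP = proj_A, dDelta = 0\<rparr>"
  by (simp add: relative_datum_def relative_M_def NR_algebra_def)

lemma generalised_V_datum_relative:
  assumes "vector_space sg" "vector_space sh"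
  shows "generalised_V_datum (relative_datum sg sh)"
proof -
  let ?sp = "module_prod.scale sg sh"
  have vp: "vector_space ?sp" by (rule vector_space_prod_scale[OF assms])
  have sub: "graded_Lie_subalgebra (NR_algebra ?sp) (relative_M_comp sg sh)"
    by (rule graded_Lie_subalgebra_relative_M[OF assms])
  then have K: "relative_M_comp sg sh n \<subseteq> Hom_comp ?sp ?sp n" for n
    by (simp add: graded_Lie_subalgebra_def NR_algebra_def)
  show ?thesis
    unfolding relative_datum_eq
  proof (rule generalised_V_datum_Hom[OF assms])
    show "graded_Lie_algebra (relative_M sg sh)"
      unfolding relative_M_def by (rule graded_Lie_algebra_subalgebra[OF graded_Lie_NR_algebra[OF vp] sub])
    show "graded_Lie_hom (relative_M sg sh) (NR_algebra ?sp) id"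
      unfolding relative_M_def by (rule graded_Lie_hom_id_subalgebra) (simp add: NR_algebra_def K)
    show "alt_form ?sp ?sp (id F)" if "F \<in> gtotal (relative_M sg sh)" for F
      using gtotal_alt_form[OF vp vp _ _ that] K by (simp add: relative_M_def NR_algebra_def)
  qed simp
qed

lemma iota_M_graded_Lie_hom:
  assumes "vector_space s"
  shows "graded_Lie_hom (NR_algebra s) (relative_M s s) (iota_M s)"
    "graded_Lie_hom (NR_algebra s) (NR_algebra (module_prod.scale s s)) (iota_M s)"
proof -
  have tot: "alt_form s s f" if "f \<in> gtotal (NR_algebra s)" for f
    using gtotal_alt_form[OF assms assms _ _ that] by (simp add: NR_algebra_def)
  show "graded_Lie_hom (NR_algebra s) (relative_M s s) (iota_M s)"
    "graded_Lie_hom (NR_algebra s) (NR_algebra (module_prod.scale s s)) (iota_M s)"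
    unfolding graded_Lie_hom_def graded_linear_map_def
    using tot iota_M_add[OF assms] iota_M_scale[OF assms] iota_M_bracket[OF assms]
      iota_M_Hom_comp[OF assms] iota_M_relative_M_comp[OF assms]
    by (simp_all add: relative_M_def NR_algebra_def)
qed

lemma generalised_V_datum_absolute:
  assumes "vector_space s"
  shows "generalised_V_datum (absolute_datum s)"
proof -
  let ?sp = "module_prod.scale s s"
  have tot: "alt_form s s f" if "f \<in> gtotal (NR_algebra s)" for f
    using gtotal_alt_form[OF assms assms _ _ that] by (simp add: NR_algebra_def)
  have vp: "vector_space ?sp" by (rule vector_space_prod_scale[OF assms assms])
  show ?thesis
    unfolding absolute_datum_def
  proof (rule generalised_V_datum_Hom[OF assms assms])
    show "inj_on (iota_M s) (gtotal (NR_algebra s))"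
      using iota_M_inject[OF assms] tot by (auto intro!: inj_onI)
    show "alt_form ?sp ?sp (iota_M s f)" if "f \<in> gtotal (NR_algebra s)" for f
      by (rule alt_form_iota_M[OF assms tot[OF that]])
  qed (intro graded_Lie_NR_algebra iota_M_graded_Lie_hom assms)+
qed

lemma V_datum_morphism_absolute_relative:
  assumes "vector_space s"
  shows "V_datum_morphism (absolute_datum s) (relative_datum s s) id (iota_M s) id"
  unfolding V_datum_morphism_def
  using generalised_V_datum_absolute[OF assms] generalised_V_datum_relative[OF assms assms]
    iota_M_graded_Lie_hom(1)[OF assms]
  by (simp add: absolute_datum_def relative_datum_eq)
    (simp add: graded_Lie_hom_def graded_linear_map_def)

text \<open>The span argument of \<open>gtotal_alt_form\<close> for pairs; additivity and
  injectivity on the whole total space, where degrees may mix, rest on it.\<close>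

lemma Linf_algebra_absolute_alt_form:
  assumes "vector_space s" "v \<in> gtotal (Linf_algebra_of lam (absolute_datum s))"
  shows "alt_form s s (fst v)"
proof -
  let ?S = "module_prod.scale (Hom_scale s) (Hom_scale s)" and ?T = "{v. alt_form s s (fst v)}"
  have vH: "vector_space (Hom_scale s)" by (rule vector_space_Hom_scale[OF assms(1)])
  have vs: "vector_space ?S" by (rule vector_space_prod_scale[OF vH vH])
  have "module.subspace ?S ?T"
    unfolding subspace_iff[OF vs] using assms(1)
    by (simp add: scale_prod_eq[OF vH vH] alt_form_0 alt_form_plus alt_form_scaled
        Hom_scale_def zero_fun_def plus_fun_def)
  moreover have "(\<Union>d. gcomp (Linf_algebra_of lam (absolute_datum s)) d) \<subseteq> ?T"
    using Hom_comp_alt_form[OF assms(1,1)]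
    by (auto simp: Linf_algebra_of_def absolute_datum_def NR_algebra_def)
  ultimately have "module.span ?S (\<Union>d. gcomp (Linf_algebra_of lam (absolute_datum s)) d) \<subseteq> ?T"
    using vs by (intro module.span_minimal) (simp add: module_iff_vector_space)
  then show ?thesis
    using assms(2)
    by (auto simp: gtotal_def Linf_algebra_of_def absolute_datum_def NR_algebra_def abelian_Hom_def)
qed

lemma Linf_hom_absolute_relative:
  assumes "vector_space s"
  shows "Linf_hom (Linf_algebra_of lam (absolute_datum s)) (Linf_algebra_of lam (relative_datum s s))
      (\<lambda>(h, \<xi>). (iota_M s h, id \<xi>))" (is "Linf_hom ?V ?W ?f")
proof -
  let ?sp = "module_prod.scale s s"
  have vp: "vector_space ?sp" by (rule vector_space_prod_scale[OF assms assms])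
  have vH: "vector_space (Hom_scale s)" "vector_space (Hom_scale ?sp)"
    by (rule vector_space_Hom_scale[OF assms] vector_space_Hom_scale[OF vp])+
  note tot = Linf_algebra_absolute_alt_form[OF assms]
  have 0: "iota_M s 0 = 0"
  proof -
    have "alt_form s s 0" using alt_form_0[OF assms] by (simp add: zero_fun_def)
    then show ?thesis using iota_M_add[OF assms, of 0 0] by simp
  qed
  have "graded_linear_map ?V ?W ?f"
    unfolding graded_linear_map_def
  proof (intro conjI ballI allI)
    fix x y assume "x \<in> gtotal ?V" "y \<in> gtotal ?V"
    then show "?f (x + y) = ?f x + ?f y"
      using iota_M_add[OF assms tot tot] by (simp add: case_prod_unfold)
  next
    fix c x assume "x \<in> gtotal ?V"
    then show "?f (gscale ?V c x) = gscale ?W c (?f x)"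
      using iota_M_scale[OF assms tot]
      by (simp add: Linf_algebra_of_def absolute_datum_def relative_datum_eq relative_M_def NR_algebra_def
          abelian_Hom_def case_prod_unfold scale_prod_eq[OF vH(1,1)] scale_prod_eq[OF vH(2,1)])
  next
    fix n x assume "x \<in> gcomp ?V n"
    then show "?f x \<in> gcomp ?W n"
      using iota_M_relative_M_comp[OF assms]
      by (auto simp: Linf_algebra_of_def absolute_datum_def relative_datum_eq relative_M_def NR_algebra_def
          abelian_Hom_def)
  qed
  moreover have "?f (gop ?V ds vs) = gop ?W ds (map ?f vs)"
    if "list_all2 (\<lambda>d v. v \<in> gcomp ?V d) ds vs" for ds vs
  proof -
    have alt: "alt_form s s (fst (vs ! j))" if j: "j < length vs" for j
    proof -
      have "vs ! j \<in> gcomp ?V (ds ! j)"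
        using \<open>list_all2 _ ds vs\<close> j by (simp add: list_all2_conv_all_nth)
      then show ?thesis
        using Hom_comp_alt_form[OF assms assms]
        by (auto simp: Linf_algebra_of_def absolute_datum_def NR_algebra_def)
    qed
    \<comment> \<open>For two arguments this is compatibility with scalars and brackets. For any
      other number the component in sM is 0, and \<open>iota_M\<close> sends 0 to 0.\<close>
    have "iota_M s (fst (Linf_ops lam (absolute_datum s) ds vs)) =
        fst (Linf_ops lam (relative_datum s s) ds (map ?f vs))"
      using iota_M_scale[OF assms alt_form_NR_bracket[OF assms alt alt]]
        iota_M_bracket[OF assms alt alt]
      by (simp add: Linf_ops_def absolute_datum_def relative_datum_eq relative_M_def NR_algebra_def 0
          case_prod_unfold)
    \<comment> \<open>The summands agree one by one: the target embeds M' by \<open>id\<close>, but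
      the map has already replaced each entry \<open>h\<close> by \<open>iota_M s h\<close>, so both
      sides contain the same iterated brackets.\<close>
    moreover have "snd (Linf_ops lam (absolute_datum s) ds vs) =
        snd (Linf_ops lam (relative_datum s s) ds (map ?f vs))"
      by (auto simp: Linf_ops_def absolute_datum_def relative_datum_eq relative_M_def NR_algebra_def
          case_prod_unfold take_map drop_map o_def intro!: sum.cong)
    ultimately show ?thesis
      by (simp add: Linf_algebra_of_def prod_eq_iff case_prod_unfold)
  qed
  ultimately show ?thesis by (simp add: Linf_hom_def)
qed

theorem proposition4p22:
  fixes s :: "'k::field_char_0 \<Rightarrow> 'g::ab_group_add \<Rightarrow> 'g"
    and lam :: 'k
    and mu :: "'g \<Rightarrow> 'g \<Rightarrow> 'g"
    and d :: "'g \<Rightarrow> 'g"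
  assumes "differential_Lie_algebra s lam mu d"
  shows "V_datum_morphism (absolute_datum s) (relative_datum s s) id (iota_M s) id \<and>
    Linf_hom (Linf_algebra_of lam (absolute_datum s)) (Linf_algebra_of lam (relative_datum s s))
      (\<lambda>(h, \<xi>). (iota_M s h, id \<xi>)) \<and>
    inj_on (\<lambda>(h, \<xi>). (iota_M s h, id \<xi>)) (gtotal (Linf_algebra_of lam (absolute_datum s)))"
proof -
  have s: "vector_space s"
    using assms by (simp add: differential_Lie_algebra_def Lie_algebra_def)
  have "inj_on (\<lambda>(h, \<xi>). (iota_M s h, id \<xi>)) (gtotal (Linf_algebra_of lam (absolute_datum s)))"
  proof (rule inj_onI)
    fix v w assume "v \<in> gtotal (Linf_algebra_of lam (absolute_datum s))"
      "w \<in> gtotal (Linf_algebra_of lam (absolute_datum s))"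
    note alt = this[THEN Linf_algebra_absolute_alt_form[OF s]]
    assume "(\<lambda>(h, \<xi>). (iota_M s h, id \<xi>)) v = (\<lambda>(h, \<xi>). (iota_M s h, id \<xi>)) w"
    then have "iota_M s (fst v) = iota_M s (fst w)" "snd v = snd w"
      by (simp_all add: case_prod_unfold)
    then show "v = w" using iota_M_inject[OF s alt] by (simp add: prod_eq_iff)
  qed
  then show ?thesis
    using V_datum_morphism_absolute_relative[OF s] Linf_hom_absolute_relative[OF s] by blast
qed

end
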